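(* Let $\mathcal{A}:\mathbb{R}^{m\times n}\to\mathbb{R}^l$ be a given linear operator with $m\le n$, and let $p\in(0,1)$ be given. Consider, for $y \in \mathbb{R}^l$, the problem $$(\mathrm{P}_y)\qquad \text{minimize } \|X\|_p^p \quad\text{subject to } \mathcal{A}(X)=y,\; X\in\mathbb{R}^{m\times n}.$$ (a) Let $k\ge 1$ be an integer such that $2k\le m$. Suppose there exists a constant $\alpha_{2k}\in(0,1)$ such that $$(1-\alpha_{2k})\|X\|_F^2\le\|\mathcal{A}(X)\|_2^2\le(1+\alpha_{2k})\|X\|_F^2$$ for all $X\in\mathbb{R}^{m\times n}$ with $\mathrm{rank}(X)\le 2k$, and that $p<\min\{1,\,1.0873\times(1-\alpha_{2k})\}$. Then every matrix $\bar{X}\in\mathbb{R}^{m\times n}$ with $\mathrm{rank}(\bar{X})\le k$ and $y=\mathcal{A}(\bar{X})$ can be exactly recovered by solving $(\mathrm{P}_y)$. (b) Given an integer $k\ge 1$ and a real number $b>1$, let $a=\lceil b^{2/(2-p)}k\rceil/k$, and suppose $(a+1)k\le m$. Suppose that for $r=ak$ and for $r=(a+1)k$ there exist constants $\beta_{p,r}\in(0,1)$ such that $$(1-\beta_{p,r})\|X\|_F^p\le\|\mathcal{A}(X)\|_p^p\le(1+\beta_{p,r})\|X\|_F^p$$ for all $X\in\mathbb{R}^{m\times n}$ with $\mathrm{rank}(X)\le r$, and that $\beta_{p,ak}+b\,\beta_{p,(a+1)k}<b-1$. Then every matrix $\bar{X}\in\mathbb{R}^{m\times n}$ with $\mathrm{rank}(\bar{X})\le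 k$ and $y=\mathcal{A}(\bar{X})$ can be exactly recovered by solving $(\mathrm{P}_y)$.
   Context: For a matrix $X\in\mathbb{R}^{m\times n}$ with $m\le n$, $\|X\|_p^p=\sum_{i=1}^{m}\sigma_i(X)^p$, where $\sigma_i(X)$ is the $i$-th largest singular value, and $\|X\|_F$ is the Frobenius norm. For a vector $v\in\mathbb{R}^l$, $\|v\|_2$ is the Euclidean norm and $\|v\|_p^p=\sum_{i=1}^l|v_i|^p$. "Exactly recovered by solving $(\mathrm{P}_y)$" means that $\bar{X}$ is the unique optimal solution of $(\mathrm{P}_y)$ with $y=\mathcal{A}(\bar X)$. *)

theory Defs
  imports "HOL-Analysis.Analysis" "HOL-Computational_Algebra.Computational_Algebra"
begin

definition char_poly_mat :: "real ^ 'm ^ 'm \<Rightarrow> real poly" where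
  "char_poly_mat M = det ((\<chi> i j. (if i = j then [:0, 1:] else 0) - [:M $ i $ j:]) :: real poly ^ 'm ^ 'm)"

text \<open>
  For an \<open>m \<times> n\<close> matrix with \<open>m \<le> n\<close>, the \<open>m\<close> singular values are the square roots of the
  eigenvalues of \<open>X X\<^sup>T\<close>, counted with multiplicity.  The list is sorted in decreasing order,
  so the 0-based list index \<open>i - 1\<close> holds the \<open>i\<close>-th largest one.
\<close>

definition singular_values :: "real ^ 'n ^ 'm \<Rightarrow> real list" where
  "singular_values X =
     rev (sorted_list_of_multiset (image_mset sqrt (proots (char_poly_mat (X ** transpose X)))))"

definition singular_value :: "nat \<Rightarrow> real ^ 'n ^ 'm \<Rightarrow> real" where
  "singular_value i X = singular_values X ! (i - 1)"

text \<open>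
  \<open>schatten_pow p X\<close> and \<open>lp_pow p v\<close> are the \<open>p\<close>-th powers of the Schatten and
  \<open>\<ell>\<^sub>p\<close> quasi-norms, for \<open>p > 0\<close> (note \<open>0 powr p = 0\<close>).  The former is only meaningful
  for matrices with at most as many rows as columns.
\<close>

definition schatten_pow :: "real \<Rightarrow> real ^ 'n ^ 'm \<Rightarrow> real" where
  "schatten_pow p X = (\<Sum>i = 1..CARD('m). singular_value i X powr p)"

definition lp_pow :: "real \<Rightarrow> real ^ 'l \<Rightarrow> real" where
  "lp_pow p v = (\<Sum>i\<in>UNIV. \<bar>v $ i\<bar> powr p)"

definition optimal_solution ::
    "(real ^ 'n ^ 'm \<Rightarrow> real ^ 'l) \<Rightarrow> real \<Rightarrow> real ^ 'l \<Rightarrow> real ^ 'n ^ 'm \<Rightarrow> bool" where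
  "optimal_solution A p y X \<longleftrightarrow>
     A X = y \<and> (\<forall>Z. A Z = y \<longrightarrow> schatten_pow p X \<le> schatten_pow p Z)"

definition exactly_recovered ::
    "(real ^ 'n ^ 'm \<Rightarrow> real ^ 'l) \<Rightarrow> real \<Rightarrow> real ^ 'l \<Rightarrow> real ^ 'n ^ 'm \<Rightarrow> bool" where
  "exactly_recovered A p y X \<longleftrightarrow>
     optimal_solution A p y X \<and> (\<forall>Z. optimal_solution A p y Z \<longrightarrow> Z = X)"

text \<open>The library norm on the nested vector type is the Frobenius norm.\<close>

lemma norm_eq_frobenius:
  fixes X :: "real ^ 'n ^ 'm"
  shows "norm X = sqrt (\<Sum>i\<in>UNIV. \<Sum>j\<in>UNIV. (X $ i $ j)\<^sup>2)"
  by (simp add: norm_vec_def L2_set_def sum_nonneg)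

end

theory Submission
  imports Defs
begin

text \<open>
  The core is the perturbation inequality
  \<open>\<Sum>\<^sub>i |\<sigma>\<^sub>i(Y)\<^sup>p - \<sigma>\<^sub>i(Z)\<^sup>p| \<le> \<Sum>\<^sub>i \<sigma>\<^sub>i(Y - Z)\<^sup>p\<close>.  By the triangle inequality along a singular value
  decomposition of \<open>Y - Z\<close>, it reduces to a rank-one difference \<open>c u v\<^sup>T\<close>.  There the singular values
  interlace, so that the intervals between \<open>\<sigma>\<^sub>i(Y)\<close> and \<open>\<sigma>\<^sub>i(Z)\<close> do not overlap, and the total length of
  these intervals is at most \<open>c\<close>; concavity of \<open>t\<^sup>p\<close> bounds the sum of its increments by \<open>c\<^sup>p\<close>.

  Consequently \<open>\<Sum>\<^sub>i\<^sub><\<^sub>k \<sigma>\<^sub>i(Z)\<^sup>p < \<Sum>\<^sub>i\<^sub>\<ge>\<^sub>k \<sigma>\<^sub>i(Z)\<^sup>p\<close> for all nonzero \<open>Z\<close> in the kernel of \<open>A\<close> (singular values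
  counted from \<open>0\<close>) suffices for recovery.  If it fails for some \<open>Z\<close>, cut a singular value decomposition of
  \<open>Z\<close> into a head and consecutive blocks: the head and the blocks have images that add up to \<open>0\<close>, whereas the
  restricted isometry bounds make the image of the head too large to be cancelled by those of the blocks.
\<close>

section \<open>Orthonormal families\<close>

text \<open>Families are indexed by natural numbers and only the entries below \<open>n\<close>
  count. They can thus be truncated, extended one vector at a time, and matched with eigenvalues or
  singular values listed in decreasing order.\<close>

definition orthonormal_upto :: "nat \<Rightarrow> (nat \<Rightarrow> 'a::real_inner) \<Rightarrow> bool" where
  "orthonormal_upto n e \<longleftrightarrow> (\<forall>i<n. \<forall>j<n. e i \<bullet> e j = (if i = j then 1 else 0))"

lemma orthonormal_uptoD:
  assumes "orthonormal_upto n e" "i < n" "j < n"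
  shows "e i \<bullet> e j = (if i = j then 1 else 0)"
  using assms by (simp add: orthonormal_upto_def)

lemma orthonormal_upto_mono:
  "orthonormal_upto n e \<Longrightarrow> m \<le> n \<Longrightarrow> orthonormal_upto m e"
  by (simp add: orthonormal_upto_def)

lemma orthonormal_upto_norm: "orthonormal_upto n e \<Longrightarrow> i < n \<Longrightarrow> norm (e i) = 1"
  by (simp add: orthonormal_upto_def norm_eq_sqrt_inner)

lemma orthonormal_upto_inj_on:
  assumes "orthonormal_upto n e"
  shows "inj_on e {..<n}"
proof (rule inj_onI)
  fix i j assume ij: "i \<in> {..<n}" "j \<in> {..<n}" "e i = e j"
  then have "e i \<bullet> e j = 1" using orthonormal_uptoD[OF assms, of i i] by simp
  then show "i = j" using orthonormal_uptoD[OF assms, of i j] ij by (auto split: if_splits)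
qed

lemma orthonormal_upto_pairwise:
  assumes "orthonormal_upto n e"
  shows "pairwise orthogonal (e ` {..<n})"
  unfolding pairwise_def orthogonal_def
  using orthonormal_uptoD[OF assms] by auto

lemma orthonormal_upto_independent:
  assumes "orthonormal_upto n e"
  shows "independent (e ` {..<n})"
proof (rule pairwise_orthogonal_independent[OF orthonormal_upto_pairwise[OF assms]])
  show "0 \<notin> e ` {..<n}"
    using orthonormal_upto_norm[OF assms] by fastforce
qed

lemma orthonormal_upto_dim_span:
  fixes e :: "nat \<Rightarrow> 'a::euclidean_space"
  assumes "orthonormal_upto n e"
  shows "dim (span (e ` {..<n})) = n"
  using dim_span_eq_card_independent[OF orthonormal_upto_independent[OF assms]]
    card_image[OF orthonormal_upto_inj_on[OF assms]] by simp

lemma orthonormal_upto_expand_span: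
  fixes e :: "nat \<Rightarrow> 'a::euclidean_space"
  assumes e: "orthonormal_upto n e" and x: "x \<in> span (e ` {..<n})"
  shows "x = (\<Sum>i<n. (x \<bullet> e i) *\<^sub>R e i)"
proof -
  have "(\<Sum>b\<in>e ` {..<n}. (x \<bullet> b) *\<^sub>R b) = x"
    by (rule orthonormal_basis_expand[OF orthonormal_upto_pairwise[OF e]])
      (use orthonormal_upto_norm[OF e] x in auto)
  then show ?thesis
    by (simp add: sum.reindex[OF orthonormal_upto_inj_on[OF e]])
qed

lemma orthonormal_upto_expand:
  fixes e :: "nat \<Rightarrow> 'a::euclidean_space"
  assumes e: "orthonormal_upto DIM('a) e"
  shows "x = (\<Sum>i<DIM('a). (x \<bullet> e i) *\<^sub>R e i)"
proof (rule orthonormal_upto_expand_span[OF e])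
  have "span (e ` {..<DIM('a)}) = UNIV"
    using orthonormal_upto_dim_span[OF e] dim_eq_full by fastforce
  then show "x \<in> span (e ` {..<DIM('a)})" by simp
qed

lemma orthonormal_upto_inner_sum:
  assumes e: "orthonormal_upto n e"
  shows "(\<Sum>i<n. a i *\<^sub>R e i) \<bullet> (\<Sum>i<n. b i *\<^sub>R e i) = (\<Sum>i<n. a i * b i)"
proof -
  have "(\<Sum>i<n. a i *\<^sub>R e i) \<bullet> (\<Sum>i<n. b i *\<^sub>R e i)
      = (\<Sum>i<n. \<Sum>j<n. a i * b j * (e i \<bullet> e j))"
    unfolding inner_sum_left unfolding inner_sum_right
    by (intro sum.cong refl) (simp add: inner_commute)
  also have "\<dots> = (\<Sum>i<n. \<Sum>j<n. if i = j then a i * b j else 0)"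
    by (intro sum.cong refl) (use orthonormal_uptoD[OF e] in auto)
  finally show ?thesis by simp
qed

lemma orthonormal_upto_parseval:
  fixes e :: "nat \<Rightarrow> 'a::euclidean_space"
  assumes e: "orthonormal_upto DIM('a) e"
  shows "x \<bullet> y = (\<Sum>i<DIM('a). (x \<bullet> e i) * (y \<bullet> e i))"
  using orthonormal_upto_inner_sum[OF e, of "\<lambda>i. x \<bullet> e i" "\<lambda>i. y \<bullet> e i"]
    orthonormal_upto_expand[OF e] by metis

text \<open>Bessel's inequality: the squared distance from \<open>x\<close> to its projection
  \<open>?y\<close> is nonnegative.\<close>

lemma orthonormal_upto_bessel:
  assumes e: "orthonormal_upto n e"
  shows "(\<Sum>i<n. (x \<bullet> e i)\<^sup>2) \<le> x \<bullet> x"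
proof -
  let ?y = "\<Sum>i<n. (x \<bullet> e i) *\<^sub>R e i"
  have xy: "x \<bullet> ?y = (\<Sum>i<n. (x \<bullet> e i)\<^sup>2)"
    by (simp add: inner_sum_right power2_eq_square)
  have yy: "?y \<bullet> ?y = (\<Sum>i<n. (x \<bullet> e i)\<^sup>2)"
    using orthonormal_upto_inner_sum[OF e] by (simp add: power2_eq_square)
  have "0 \<le> (x - ?y) \<bullet> (x - ?y)" by simp
  also have "\<dots> = x \<bullet> x - 2 * (x \<bullet> ?y) + ?y \<bullet> ?y"
    by (simp add: inner_diff_left inner_diff_right inner_commute[of ?y x])
  finally show ?thesis unfolding xy yy by simp
qed

text \<open>The orthogonal complement of \<open>C\<close> has codimension at most
  \<open>card C\<close>, so by the dimension formula it meets \<open>S\<close> in a nonzero vector.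
  This count drives both the minimax bound for eigenvalues and the interlacing of singular
  values.\<close>

lemma exists_unit_orthogonal:
  fixes S :: "'a::euclidean_space set"
  assumes S: "subspace S" and C: "finite C" "card C < dim S"
  obtains x where "x \<in> S" "norm x = 1" "\<And>c. c \<in> C \<Longrightarrow> c \<bullet> x = 0"
proof -
  define W where "W = {y :: 'a. \<forall>c\<in>span C. orthogonal c y}"
  have W: "subspace W"
    unfolding W_def subspace_def by (auto simp: orthogonal_def inner_add_right)
  have dW: "dim W + dim (span C) = DIM('a)"
    using dim_subspace_orthogonal_to_vectors[OF subspace_span subspace_UNIV, of C] W_def by simp
  have "dim {x + y |x y. x \<in> S \<and> y \<in> W} + dim (S \<inter> W) = dim S + dim W"
    by (rule dim_sums_Int[OF S W])
  moreover have "dim {x + y |x y. x \<in> S \<and> y \<in> W} \<le> DIM('a)"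
    by (rule dim_subset_UNIV)
  moreover have "dim (span C) \<le> card C"
    using dim_le_card[OF span_superset \<open>finite C\<close>] by (simp add: dim_span)
  ultimately have "dim (S \<inter> W) \<noteq> 0" using C dW by linarith
  then obtain z where z: "z \<in> S \<inter> W" "z \<noteq> 0" unfolding dim_eq_0 by blast
  show thesis
  proof
    show "z /\<^sub>R norm z \<in> S" using z S by (simp add: subspace_scale)
    show "norm (z /\<^sub>R norm z) = 1" using z by simp
    show "c \<bullet> (z /\<^sub>R norm z) = 0" if "c \<in> C" for c
      using z span_base[OF that] by (auto simp: W_def orthogonal_def)
  qed
qed

lemma orthonormal_upto_Suc:
  assumes "orthonormal_upto n e" "norm x = 1" "\<And>i. i < n \<Longrightarrow> e i \<bullet> x = 0"
  shows "orthonormal_upto (Suc n) (e(n := x))"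
  using assms unfolding orthonormal_upto_def
  by (auto simp: less_Suc_eq norm_eq_sqrt_inner inner_commute)

lemma orthonormal_upto_extend:
  fixes e :: "nat \<Rightarrow> 'a::euclidean_space"
  assumes e: "orthonormal_upto r e" and "r \<le> n" "n \<le> DIM('a)"
  obtains e' where "orthonormal_upto n e'" "\<And>i. i < r \<Longrightarrow> e' i = e i"
proof -
  have "\<exists>e'. orthonormal_upto n e' \<and> (\<forall>i<r. e' i = e i)"
    using \<open>r \<le> n\<close> \<open>n \<le> DIM('a)\<close>
  proof (induction n rule: dec_induct)
    case base
    show ?case using e by blast
  next
    case (step n)
    then obtain e' where e': "orthonormal_upto n e'" "\<forall>i<r. e' i = e i" by auto
    have "card (e' ` {..<n}) < dim (UNIV :: 'a set)"
      using card_image_le[of "{..<n}" e'] step by simp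
    then obtain x where "norm x = 1" "\<And>c. c \<in> e' ` {..<n} \<Longrightarrow> c \<bullet> x = 0"
      using exists_unit_orthogonal[OF subspace_UNIV, of "e' ` {..<n}"] by auto
    then have "orthonormal_upto (Suc n) (e'(n := x))"
      using orthonormal_upto_Suc[OF e'(1)] by simp
    moreover have "\<forall>i<r. (e'(n := x)) i = e i" using e' step by simp
    ultimately show ?case by blast
  qed
  then show thesis using that by blast
qed

section \<open>Symmetric operators\<close>

definition eigensystem :: "('a::euclidean_space \<Rightarrow> 'a) \<Rightarrow> (nat \<Rightarrow> 'a) \<Rightarrow> (nat \<Rightarrow> real) \<Rightarrow> bool" where
  "eigensystem T e l \<longleftrightarrow> orthonormal_upto DIM('a) e \<and> (\<forall>i<DIM('a). T (e i) = l i *\<^sub>R e i)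
     \<and> (\<forall>i j. i \<le> j \<longrightarrow> j < DIM('a) \<longrightarrow> l j \<le> l i)"

text \<open>The maximiser of the quadratic form on the unit sphere of the invariant subspace
  orthogonal to the eigenvectors already found is an eigenvector.\<close>

lemma next_eigenvector:
  fixes T :: "'a::euclidean_space \<Rightarrow> 'a"
  assumes T: "linear T" and sym: "\<And>x y. T x \<bullet> y = x \<bullet> T y"
    and e: "\<And>i. i < n \<Longrightarrow> T (e i) = l i *\<^sub>R e i" and n: "n < DIM('a)"
  obtains x c where "norm x = 1" "\<forall>i<n. e i \<bullet> x = 0" "T x = c *\<^sub>R x"
    "\<forall>y. (\<forall>i<n. e i \<bullet> y = 0) \<longrightarrow> y \<bullet> T y \<le> c * (y \<bullet> y)"
proof -
  define W where "W = {x. \<forall>i<n. e i \<bullet> x = 0}"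
  have W: "subspace W" unfolding W_def subspace_def by (auto simp: inner_add_right)
  have "closed W"
  proof -
    have "W = (\<Inter>i\<in>{..<n}. {x. e i \<bullet> x = 0})" unfolding W_def by auto
    then show ?thesis using closed_hyperplane by (metis closed_INT)
  qed
  then have compact: "compact (sphere 0 1 \<inter> W)" by (intro compact_Int_closed) auto
  have "card (e ` {..<n}) < dim (UNIV :: 'a set)"
    using card_image_le[of "{..<n}" e] n by simp
  then obtain x0 where "norm x0 = 1" "\<And>c. c \<in> e ` {..<n} \<Longrightarrow> c \<bullet> x0 = 0"
    using exists_unit_orthogonal[OF subspace_UNIV, of "e ` {..<n}"] by auto
  then have "sphere 0 1 \<inter> W \<noteq> {}" unfolding W_def by auto
  moreover have "continuous_on (sphere 0 1 \<inter> W) (\<lambda>x. x \<bullet> T x)"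
    by (intro continuous_on_inner continuous_on_id linear_continuous_on)
      (use T in \<open>simp add: linear_linear\<close>)
  ultimately obtain x where x: "x \<in> sphere 0 1 \<inter> W"
    and max: "\<And>y. y \<in> sphere 0 1 \<inter> W \<Longrightarrow> y \<bullet> T y \<le> x \<bullet> T x"
    using continuous_attains_sup[OF compact] by blast
  define c where "c = x \<bullet> T x"
  have le: "y \<bullet> T y \<le> c * (y \<bullet> y)" if "y \<in> W" for y
  proof (cases "y = 0")
    case True
    then show ?thesis by simp
  next
    case False
    have "y /\<^sub>R norm y \<in> sphere 0 1 \<inter> W" using W that False by (simp add: subspace_scale)
    from max[OF this] have "(y \<bullet> T y) / (norm y)\<^sup>2 \<le> c"
      using linear_cmul[OF T] by (simp add: c_def divide_inverse power2_eq_square mult_ac)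
    then show ?thesis using False by (simp add: divide_le_eq power2_norm_eq_inner)
  qed
  have xx: "x \<bullet> x = 1" using x by (simp add: norm_eq_sqrt_inner)
  have TW: "T y \<in> W" if "y \<in> W" for y
    unfolding W_def
  proof (clarify)
    fix i assume i: "i < n"
    have "e i \<bullet> T y = T (e i) \<bullet> y" by (simp add: sym)
    also have "\<dots> = 0" using e[OF i] that i by (simp add: W_def)
    finally show "e i \<bullet> T y = 0" .
  qed
  \<comment> \<open>The residual of the eigenvector equation. The form
    \<open>c * (z \<bullet> z) - z \<bullet> T z\<close> is nonnegative on \<open>W\<close> and
    vanishes at \<open>x\<close>. Its derivative at \<open>x\<close> in the direction
    \<open>d\<close> is \<open>2 * (d \<bullet> d)\<close>, so a small step backwards would make it
    negative unless \<open>d = 0\<close>.\<close>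
  define d where "d = c *\<^sub>R x - T x"
  have d: "d \<in> W" unfolding d_def using x TW W by (simp add: subspace_diff subspace_scale)
  define Q where "Q = c * (d \<bullet> d) - d \<bullet> T d"
  have Q0: "Q \<ge> 0" using le[OF d] Q_def by simp
  have quad: "0 \<le> 2 * t * (d \<bullet> d) + t\<^sup>2 * Q" for t
  proof -
    have "x + t *\<^sub>R d \<in> W" using x d W by (simp add: subspace_add subspace_scale)
    from le[OF this] have
      "0 \<le> c * ((x + t *\<^sub>R d) \<bullet> (x + t *\<^sub>R d)) - (x + t *\<^sub>R d) \<bullet> (T x + t *\<^sub>R T d)"
      using linear_add[OF T] linear_cmul[OF T] by simp
    also have "\<dots> = 2 * t * (c * (x \<bullet> d) - d \<bullet> T x) + t\<^sup>2 * Q"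
      using sym[of x d] xx
      by (simp add: Q_def c_def inner_add_left inner_add_right algebra_simps
          power2_eq_square inner_commute)
    also have "c * (x \<bullet> d) - d \<bullet> T x = d \<bullet> (c *\<^sub>R x - T x)"
      by (simp add: inner_diff_right inner_commute)
    also have "\<dots> = d \<bullet> d" by (simp only: d_def)
    finally show ?thesis .
  qed
  have "d \<bullet> d = 0"
  proof (rule ccontr)
    assume "d \<bullet> d \<noteq> 0"
    then have pos: "d \<bullet> d > 0" by simp
    \<comment> \<open>Minimising the quadratic would suggest the denominator \<open>Q\<close>;
      \<open>Q + 1\<close> is always positive and still leaves a strictly negative value.\<close>
    define t where "t = - (d \<bullet> d) / (Q + 1)"
    have "t * (Q + 1) = - (d \<bullet> d)" using Q0 by (simp add: t_def)
    then have dd: "d \<bullet> d = - t * (Q + 1)" by simp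
    have "2 * t * (d \<bullet> d) + t\<^sup>2 * Q = - (t\<^sup>2 * Q + 2 * t\<^sup>2)"
      unfolding dd by (simp add: power2_eq_square algebra_simps)
    moreover have "t \<noteq> 0" using pos Q0 by (simp add: t_def)
    then have "t\<^sup>2 > 0" by simp
    moreover have "t\<^sup>2 * Q \<ge> 0" using Q0 by simp
    ultimately show False using quad[of t] by linarith
  qed
  then have "T x = c *\<^sub>R x" by (simp add: d_def)
  then show thesis using that[of x c] x le by (auto simp: W_def)
qed

theorem spectral_theorem:
  fixes T :: "'a::euclidean_space \<Rightarrow> 'a"
  assumes T: "linear T" and sym: "\<And>x y. T x \<bullet> y = x \<bullet> T y"
  obtains e l where "eigensystem T e l"
proof -
  \<comment> \<open>The last conjunct carries the ordering through the induction: the next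
    eigenvector is orthogonal to the earlier ones, so its eigenvalue is at most each earlier
    \<open>l i\<close>.\<close>
  have "\<exists>e l. orthonormal_upto n e \<and> (\<forall>i<n. T (e i) = l i *\<^sub>R e i)
      \<and> (\<forall>i j. i \<le> j \<longrightarrow> j < n \<longrightarrow> l j \<le> l i)
      \<and> (\<forall>y. (\<forall>i<n. e i \<bullet> y = 0) \<longrightarrow> (\<forall>i<n. y \<bullet> T y \<le> l i * (y \<bullet> y)))"
    if "n \<le> DIM('a)" for n
    using that
  proof (induction n)
    case 0
    show ?case by (simp add: orthonormal_upto_def)
  next
    case (Suc n)
    then have "n \<le> DIM('a)" by simp
    from Suc.IH[OF this] obtain e l where IH: "orthonormal_upto n e"
      "\<forall>i<n. T (e i) = l i *\<^sub>R e i" "\<forall>i j. i \<le> j \<longrightarrow> j < n \<longrightarrow> l j \<le> l i"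
      "\<forall>y. (\<forall>i<n. e i \<bullet> y = 0) \<longrightarrow> (\<forall>i<n. y \<bullet> T y \<le> l i * (y \<bullet> y))"
      by (elim exE conjE) rule
    have ev: "T (e i) = l i *\<^sub>R e i" if "i < n" for i using IH(2) that by simp
    have n: "n < DIM('a)" using Suc.prems by simp
    obtain x c where x: "norm x = 1" and orth: "\<forall>i<n. e i \<bullet> x = 0"
      and Tx: "T x = c *\<^sub>R x"
      and xmax: "\<forall>y. (\<forall>i<n. e i \<bullet> y = 0) \<longrightarrow> y \<bullet> T y \<le> c * (y \<bullet> y)"
      by (rule next_eigenvector[OF T sym ev n])
    have "x \<bullet> x = 1" using x by (simp add: norm_eq_sqrt_inner)
    then have c: "c \<le> l i" if "i < n" for i
      using IH(4) orth that Tx by auto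
    have "orthonormal_upto (Suc n) (e(n := x))" 
      using orthonormal_upto_Suc[OF IH(1) x] orth by simp
    moreover have "\<forall>i<Suc n. T ((e(n := x)) i) = (l(n := c)) i *\<^sub>R (e(n := x)) i"
      using ev Tx by (simp add: less_Suc_eq)
    moreover have "\<forall>i j. i \<le> j \<longrightarrow> j < Suc n \<longrightarrow> (l(n := c)) j \<le> (l(n := c)) i"
      using IH(3) c by (simp add: less_Suc_eq)
    moreover have "y \<bullet> T y \<le> (l(n := c)) i * (y \<bullet> y)"
      if y: "\<forall>i<Suc n. (e(n := x)) i \<bullet> y = 0" and i: "i < Suc n" for y i
    proof -
      have "\<forall>i<n. e i \<bullet> y = 0" using y by (metis fun_upd_other less_Suc_eq less_irrefl)
      then show ?thesis using IH(4) xmax i by (cases "i = n") auto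
    qed
    ultimately show ?case by blast
  qed
  from this[of "DIM('a)"] have "\<exists>e l. eigensystem T e l" unfolding eigensystem_def by blast
  then show thesis using that by blast
qed

lemma eigensystem_form:
  fixes T :: "'a::euclidean_space \<Rightarrow> 'a"
  assumes T: "linear T" and es: "eigensystem T e l"
  shows "x \<bullet> T x = (\<Sum>i<DIM('a). l i * (x \<bullet> e i)\<^sup>2)"
proof -
  have e: "orthonormal_upto DIM('a) e" using es by (simp add: eigensystem_def)
  have "T x = T (\<Sum>i<DIM('a). (x \<bullet> e i) *\<^sub>R e i)"
    using orthonormal_upto_expand[OF e] by metis
  also have "\<dots> = (\<Sum>i<DIM('a). (x \<bullet> e i) *\<^sub>R (l i *\<^sub>R e i))"
    using es by (simp add: linear_sum[OF T] linear_cmul[OF T] eigensystem_def)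
  finally have "x \<bullet> T x = (\<Sum>i<DIM('a). (x \<bullet> e i) * (l i * (x \<bullet> e i)))"
    by (simp only: inner_sum_right inner_scaleR_right)
  then show ?thesis by (simp add: power2_eq_square mult_ac)
qed

text \<open>Since \<open>dim S\<close> exceeds \<open>j\<close>, some unit vector of
  \<open>S\<close> is orthogonal to \<open>e 0\<close>, ..., \<open>e (j - 1)\<close>. There the
  quadratic form is a weighted mean of the \<open>l i\<close> with \<open>i \<ge> j\<close>, hence
  at most \<open>l j\<close>.\<close>

lemma courant_fischer_lower:
  fixes T :: "'a::euclidean_space \<Rightarrow> 'a"
  assumes T: "linear T" and es: "eigensystem T e l"
    and S: "subspace S" "j < dim S" and c: "\<And>x. x \<in> S \<Longrightarrow> c * (x \<bullet> x) \<le> x \<bullet> T x"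
  shows "c \<le> l j"
proof -
  have e: "orthonormal_upto DIM('a) e" using es by (simp add: eigensystem_def)
  have "card (e ` {..<j}) < dim S" using S card_image_le[of "{..<j}" e] by simp
  then obtain x where x: "x \<in> S" "norm x = 1" "\<And>b. b \<in> e ` {..<j} \<Longrightarrow> b \<bullet> x = 0"
    using exists_unit_orthogonal[OF S(1), of "e ` {..<j}"] by auto
  have xx: "x \<bullet> x = 1" using x by (simp add: norm_eq_sqrt_inner)
  have "c \<le> x \<bullet> T x" using c[OF x(1)] xx by simp
  also have "\<dots> = (\<Sum>i<DIM('a). l i * (x \<bullet> e i)\<^sup>2)" by (rule eigensystem_form[OF T es])
  also have "\<dots> \<le> (\<Sum>i<DIM('a). l j * (x \<bullet> e i)\<^sup>2)"
  proof (rule sum_mono)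
    fix i assume "i \<in> {..<DIM('a)}"
    then show "l i * (x \<bullet> e i)\<^sup>2 \<le> l j * (x \<bullet> e i)\<^sup>2"
      using x(3)[of "e i"] es
      by (cases "i < j") (auto simp: eigensystem_def inner_commute intro!: mult_right_mono)
  qed
  also have "\<dots> = l j * (\<Sum>i<DIM('a). (x \<bullet> e i) * (x \<bullet> e i))"
    by (simp add: sum_distrib_left power2_eq_square)
  also have "\<dots> = l j" using orthonormal_upto_parseval[OF e, of x x] xx by simp
  finally show ?thesis .
qed

text \<open>Expand each \<open>b \<bullet> T b\<close> in the eigenbasis and swap the sums; what
  remains of each \<open>l i\<close> is its product with the squared length of
  \<open>e i\<close>.\<close>

lemma trace_eq_sum_eigenvalues:
  fixes T :: "'a::euclidean_space \<Rightarrow> 'a"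
  assumes T: "linear T" and es: "eigensystem T e l"
  shows "(\<Sum>b\<in>Basis. b \<bullet> T b) = (\<Sum>i<DIM('a). l i)"
proof -
  have e: "orthonormal_upto DIM('a) e" using es by (simp add: eigensystem_def)
  have "(\<Sum>b\<in>Basis. b \<bullet> T b) = (\<Sum>i<DIM('a). \<Sum>b\<in>Basis. l i * (b \<bullet> e i)\<^sup>2)"
    by (subst sum.swap) (simp add: eigensystem_form[OF T es])
  also have "\<dots> = (\<Sum>i<DIM('a). l i * (e i \<bullet> e i))"
  proof (intro sum.cong refl)
    fix i
    have "e i \<bullet> e i = (\<Sum>b\<in>Basis. (b \<bullet> e i)\<^sup>2)"
      by (subst euclidean_inner) (simp add: power2_eq_square inner_commute)
    then show "(\<Sum>b\<in>Basis. l i * (b \<bullet> e i)\<^sup>2) = l i * (e i \<bullet> e i)"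
      by (simp add: sum_distrib_left)
  qed
  also have "\<dots> = (\<Sum>i<DIM('a). l i)" using orthonormal_uptoD[OF e] by simp
  finally show ?thesis .
qed

section \<open>Singular value decomposition\<close>

declare transpose_matrix_vector [simp del]

definition outer :: "real ^ 'm \<Rightarrow> real ^ 'n \<Rightarrow> real ^ 'n ^ 'm" where
  "outer u v = (\<chi> i j. u $ i * v $ j)"

lemma outer_mult_vec: "outer u v *v x = (v \<bullet> x) *\<^sub>R u"
  by (simp add: outer_def matrix_vector_mult_def vec_eq_iff inner_vec_def sum_distrib_left mult_ac)

lemma transpose_outer: "transpose (outer u v) = outer v u"
  by (simp add: outer_def transpose_def vec_eq_iff mult.commute)

lemma inner_outer: "outer u v \<bullet> outer u' v' = (u \<bullet> u') * (v \<bullet> v')"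
  unfolding outer_def inner_vec_def sum_product by (simp add: mult_ac)

lemma sum_mult_vec:
  fixes F :: "'i \<Rightarrow> real ^ 'n ^ 'm"
  shows "(\<Sum>i\<in>I. F i) *v x = (\<Sum>i\<in>I. F i *v x)"
  by (induction I rule: infinite_finite_induct) (simp_all add: matrix_vector_mult_add_rdistrib)

lemma transpose_sum: "transpose (\<Sum>i\<in>I. F i) = (\<Sum>i\<in>I. transpose (F i))"
  by (induction I rule: infinite_finite_induct) (simp_all add: transpose_def vec_eq_iff)

lemma inner_transpose_mult_vec:
  fixes X :: "real ^ 'n ^ 'm"
  shows "(transpose X *v x) \<bullet> y = x \<bullet> (X *v y)"
  by (metis dot_lmul_matrix transpose_matrix_vector)

text \<open>The thin decomposition, with as many right as left singular vectors. Extending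
  \<open>s\<close> by zeros makes it monotone on all natural numbers, which yields nonnegativity and
  lets index sets run past \<open>CARD('m)\<close>.\<close>

definition svd :: "real ^ 'n ^ 'm \<Rightarrow> (nat \<Rightarrow> real ^ 'm) \<Rightarrow> (nat \<Rightarrow> real ^ 'n) \<Rightarrow> (nat \<Rightarrow> real) \<Rightarrow> bool" where
  "svd X u v s \<longleftrightarrow> orthonormal_upto CARD('m) u \<and> orthonormal_upto CARD('m) v
     \<and> antimono s \<and> (\<forall>i\<ge>CARD('m). s i = 0)
     \<and> X = (\<Sum>i<CARD('m). s i *\<^sub>R outer (u i) (v i))"

lemma svd_nonneg:
  fixes X :: "real ^ 'n ^ 'm"
  assumes "svd X u v s"
  shows "0 \<le> s i"
proof -
  have "s (max i CARD('m)) \<le> s i" using assms by (intro antimonoD[of s]) (auto simp: svd_def)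
  then show ?thesis using assms by (simp add: svd_def)
qed

lemma svd_decreasing: "svd X u v s \<Longrightarrow> i \<le> j \<Longrightarrow> s j \<le> s i"
  by (auto simp: svd_def intro: antimonoD)

lemma svd_mult_vec:
  fixes X :: "real ^ 'n ^ 'm"
  assumes "svd X u v s"
  shows "X *v y = (\<Sum>i<CARD('m). (s i * (v i \<bullet> y)) *\<^sub>R u i)"
proof -
  have "X = (\<Sum>i<CARD('m). s i *\<^sub>R outer (u i) (v i))" using assms by (simp add: svd_def)
  then have "X *v y = (\<Sum>i<CARD('m). s i *\<^sub>R outer (u i) (v i)) *v y" by simp
  also have "\<dots> = (\<Sum>i<CARD('m). s i *\<^sub>R (outer (u i) (v i) *v y))"
    by (simp add: sum_mult_vec scaleR_matrix_vector_assoc)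
  finally show ?thesis by (simp add: outer_mult_vec)
qed

lemma svd_transpose_mult_vec:
  fixes X :: "real ^ 'n ^ 'm"
  assumes "svd X u v s"
  shows "transpose X *v x = (\<Sum>i<CARD('m). (s i * (u i \<bullet> x)) *\<^sub>R v i)"
proof -
  have "X = (\<Sum>i<CARD('m). s i *\<^sub>R outer (u i) (v i))" using assms by (simp add: svd_def)
  then have "transpose X *v x = transpose (\<Sum>i<CARD('m). s i *\<^sub>R outer (u i) (v i)) *v x" by simp
  also have "\<dots> = (\<Sum>i<CARD('m). s i *\<^sub>R (outer (v i) (u i) *v x))"
    by (simp add: sum_mult_vec scaleR_matrix_vector_assoc transpose_sum transpose_scalar transpose_outer)
  finally show ?thesis by (simp add: outer_mult_vec)
qed

lemma svd_right_vector:
  fixes X :: "real ^ 'n ^ 'm"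
  assumes X: "svd X u v s" and i: "i < CARD('m)"
  shows "X *v v i = s i *\<^sub>R u i"
proof -
  have "v j \<bullet> v i = (if j = i then 1 else 0)" if "j < CARD('m)" for j
    using X i that by (auto simp: svd_def orthonormal_upto_def)
  then have "X *v v i = (\<Sum>j<CARD('m). if j = i then s i *\<^sub>R u i else 0)"
    unfolding svd_mult_vec[OF X] by (intro sum.cong) auto
  then show ?thesis using i by simp
qed

lemma svd_left_vector:
  fixes X :: "real ^ 'n ^ 'm"
  assumes X: "svd X u v s" and i: "i < CARD('m)"
  shows "transpose X *v u i = s i *\<^sub>R v i"
proof -
  have "u j \<bullet> u i = (if j = i then 1 else 0)" if "j < CARD('m)" for j
    using X i that by (auto simp: svd_def orthonormal_upto_def)
  then have "transpose X *v u i = (\<Sum>j<CARD('m). if j = i then s i *\<^sub>R v i else 0)"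
    unfolding svd_transpose_mult_vec[OF X] by (intro sum.cong) auto
  then show ?thesis using i by simp
qed

text \<open>Take for \<open>u\<close> the eigenvectors of \<open>X ** transpose X\<close> and for
  \<open>v\<close> the normalised images \<open>transpose X *v u i\<close> at positive eigenvalues.
  The remaining \<open>v i\<close> are any orthonormal completion, for which
  \<open>m \<le> n\<close> leaves room.\<close>

theorem svd_exists:
  fixes X :: "real ^ 'n ^ 'm"
  assumes mn: "CARD('m) \<le> CARD('n)"
  obtains u v s where "svd X u v s"
proof -
  define T where "T = (\<lambda>x. X *v (transpose X *v x))"
  have Tin: "x \<bullet> T y = (transpose X *v x) \<bullet> (transpose X *v y)" for x y
    by (simp add: T_def inner_transpose_mult_vec)
  have T: "linear T"
    unfolding T_def by (intro linear_compose[unfolded o_def, of "\<lambda>x. transpose X *v x" "\<lambda>y. X *v y"]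
        matrix_vector_mul_linear)
  have sym: "T x \<bullet> y = x \<bullet> T y" for x y
    by (metis Tin inner_commute)
  obtain u l where "eigensystem T u l" using spectral_theorem[OF T sym] by blast
  then have u: "orthonormal_upto CARD('m) u" and Tu: "\<And>i. i < CARD('m) \<Longrightarrow> T (u i) = l i *\<^sub>R u i"
    and dec: "\<And>i j. i \<le> j \<Longrightarrow> j < CARD('m) \<Longrightarrow> l j \<le> l i"
    by (auto simp: eigensystem_def)
  define w where "w = (\<lambda>i. transpose X *v u i)"
  have ww: "w i \<bullet> w j = (if i = j then l i else 0)" if "i < CARD('m)" "j < CARD('m)" for i j
    using Tin[of "u i" "u j"] Tu orthonormal_uptoD[OF u] that by (auto simp: w_def)
  have l0: "0 \<le> l i" if "i < CARD('m)" for i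
    using ww[OF that that] by (metis inner_ge_zero)
  \<comment> \<open>The number of positive eigenvalues; the alternative \<open>i = CARD('m)\<close>
    provides a witness when all of them are positive.\<close>
  define r where "r = (LEAST i. i = CARD('m) \<or> l i \<le> 0)"
  have rP: "r = CARD('m) \<or> l r \<le> 0" unfolding r_def by (rule LeastI_ex) blast
  have rm: "r \<le> CARD('m)" unfolding r_def by (rule Least_le) simp
  have pos: "0 < l i" if "i < r" for i
    using not_less_Least[of i "\<lambda>i. i = CARD('m) \<or> l i \<le> 0"] that by (auto simp: r_def)
  have zero: "l i = 0" if "r \<le> i" "i < CARD('m)" for i
    using rP dec[of r i] l0[of i] that by auto
  have "orthonormal_upto r (\<lambda>i. w i /\<^sub>R sqrt (l i))"
    unfolding orthonormal_upto_def
  proof (intro allI impI)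
    fix i j assume ij: "i < r" "j < r"
    have "sqrt (l i) * sqrt (l i) = l i" using pos[OF ij(1)] by simp
    then show "(w i /\<^sub>R sqrt (l i)) \<bullet> (w j /\<^sub>R sqrt (l j)) = (if i = j then 1 else 0)"
      using ww[of i j] rm ij pos[OF ij(1)] by (auto simp: field_simps)
  qed
  then obtain v where v: "orthonormal_upto CARD('m) v" and vw: "\<And>i. i < r \<Longrightarrow> v i = w i /\<^sub>R sqrt (l i)"
    by (rule orthonormal_upto_extend[where n = "CARD('m)"]) (use rm mn in auto)
  define s where "s = (\<lambda>i. if i < CARD('m) then sqrt (l i) else 0)"
  have wsv: "w i = s i *\<^sub>R v i" if "i < CARD('m)" for i
  proof (cases "i < r")
    case True
    then show ?thesis using pos[OF True] vw[OF True] that by (simp add: s_def)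
  next
    case False
    then have "l i = 0" using zero that by simp
    then show ?thesis using ww[OF that that] that by (simp add: s_def)
  qed
  have "transpose X = (\<Sum>i<CARD('m). s i *\<^sub>R outer (v i) (u i))"
    unfolding matrix_eq
  proof
    fix x
    have "transpose X *v x = transpose X *v (\<Sum>i<CARD('m). (x \<bullet> u i) *\<^sub>R u i)"
      using orthonormal_upto_expand[of u x] u by simp
    also have "\<dots> = (\<Sum>i<CARD('m). (x \<bullet> u i) *\<^sub>R w i)"
      by (simp add: w_def linear_sum[OF matrix_vector_mul_linear] linear_cmul[OF matrix_vector_mul_linear])
    also have "\<dots> = (\<Sum>i<CARD('m). s i *\<^sub>R outer (v i) (u i)) *v x"
      unfolding sum_mult_vec
      by (intro sum.cong refl)
        (simp add: wsv outer_mult_vec inner_commute mult.commute flip: scaleR_matrix_vector_assoc)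
    finally show "transpose X *v x = (\<Sum>i<CARD('m). s i *\<^sub>R outer (v i) (u i)) *v x" .
  qed
  then have "transpose (transpose X) = (\<Sum>i<CARD('m). s i *\<^sub>R outer (u i) (v i))"
    by (simp only: transpose_sum transpose_scalar transpose_outer)
  then have X: "X = (\<Sum>i<CARD('m). s i *\<^sub>R outer (u i) (v i))" by simp
  have "antimono s"
    unfolding s_def antimono_def using dec l0 by auto
  then have "svd X u v s"
    unfolding svd_def using u v X by (simp add: s_def)
  then show thesis by (rule that)
qed

section \<open>The Hermitian dilation\<close>

text \<open>The symmetric block operator with zero diagonal blocks and off-diagonal blocks
  \<open>Z\<close> and \<open>transpose Z\<close>. It turns statements about singular values into
  statements about eigenvalues.\<close>

definition dilation :: "real ^ 'n ^ 'm \<Rightarrow> (real ^ 'm) \<times> (real ^ 'n) \<Rightarrow> (real ^ 'm) \<times> (real ^ 'n)" where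
  "dilation Z z = (Z *v snd z, transpose Z *v fst z)"

lemma linear_dilation: "linear (dilation Z)"
  by (rule linearI)
    (simp_all add: dilation_def matrix_vector_right_distrib linear_cmul[OF matrix_vector_mul_linear])

lemma inner_dilation: "z \<bullet> dilation Z z' = fst z \<bullet> (Z *v snd z') + fst z' \<bullet> (Z *v snd z)"
  by (cases z; cases z') (simp add: dilation_def inner_commute[of _ "transpose Z *v _"] inner_transpose_mult_vec)

text \<open>\<open>S\<close> is spanned by the vectors \<open>(u j, v j)\<close> with
  \<open>j \<le> i\<close>, which are eigenvectors for the eigenvalues
  \<open>s j \<ge> s i\<close>.\<close>

lemma dilation_lower_top:
  fixes Z :: "real ^ 'n ^ 'm"
  assumes Z: "svd Z u v s" and i: "i < CARD('m)"
  obtains S where "subspace S" "i < dim S" "\<And>z. z \<in> S \<Longrightarrow> s i * (z \<bullet> z) \<le> z \<bullet> dilation Z z"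
proof -
  define f where "f = (\<lambda>j. (u j, v j) /\<^sub>R sqrt 2)"
  have "orthonormal_upto CARD('m) f"
    using Z unfolding svd_def orthonormal_upto_def f_def by (auto simp: field_simps)
  then have f: "orthonormal_upto (Suc i) f" by (rule orthonormal_upto_mono) (use i in simp)
  have Hf: "dilation Z (f j) = s j *\<^sub>R f j" if "j < CARD('m)" for j
    using svd_right_vector[OF Z that] svd_left_vector[OF Z that]
    by (simp add: f_def linear_cmul[OF linear_dilation] del: scaleR_Pair)
      (simp add: dilation_def mult.commute)
  show thesis
  proof
    show "subspace (span (f ` {..<Suc i}))" by simp
    show "i < dim (span (f ` {..<Suc i}))" using orthonormal_upto_dim_span[OF f] by simp
    fix z assume "z \<in> span (f ` {..<Suc i})"
    then have "z = (\<Sum>j<Suc i. (z \<bullet> f j) *\<^sub>R f j)"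
      by (rule orthonormal_upto_expand_span[OF f])
    then obtain a where z: "z = (\<Sum>j<Suc i. a j *\<^sub>R f j)"
      by (rule that[of "\<lambda>j. z \<bullet> f j"])
    have "dilation Z z = (\<Sum>j<Suc i. (a j * s j) *\<^sub>R f j)"
      unfolding z linear_sum[OF linear_dilation]
      by (intro sum.cong refl) (use i Hf in \<open>simp add: linear_cmul[OF linear_dilation]\<close>)
    then have "z \<bullet> dilation Z z = (\<Sum>j<Suc i. a j * (a j * s j))"
      using orthonormal_upto_inner_sum[OF f] z by simp
    also have "\<dots> \<ge> (\<Sum>j<Suc i. s i * (a j * a j))"
    proof (rule sum_mono)
      fix j assume "j \<in> {..<Suc i}"
      then have "s i * (a j * a j) \<le> s j * (a j * a j)"
        using svd_decreasing[OF Z, of j i] by (intro mult_right_mono) auto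
      then show "s i * (a j * a j) \<le> a j * (a j * s j)" by (simp add: mult_ac)
    qed
    also have "(\<Sum>j<Suc i. s i * (a j * a j)) = s i * (z \<bullet> z)"
      using orthonormal_upto_inner_sum[OF f, of a a] z by (simp add: sum_distrib_left del: sum.lessThan_Suc)
    finally show "s i * (z \<bullet> z) \<le> z \<bullet> dilation Z z" .
  qed
qed

text \<open>\<open>S\<close> is the orthogonal complement of the eigenvectors
  \<open>(u j, - v j)\<close> with \<open>j < i\<close>, which belong to the eigenvalues
  \<open>- s j\<close>. Orthogonality makes the terms with \<open>j < i\<close> nonnegative; the
  other terms are controlled by \<open>s j \<le> s i\<close>, and Bessel's inequality finishes the
  estimate.\<close>

lemma dilation_lower_bottom:
  fixes Z :: "real ^ 'n ^ 'm"
  assumes Z: "svd Z u v s" and i: "i \<le> CARD('m)"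
  obtains S where "subspace S" "CARD('m) + CARD('n) \<le> dim S + i"
    "\<And>z. z \<in> S \<Longrightarrow> - s i * (z \<bullet> z) \<le> z \<bullet> dilation Z z"
proof -
  define C where "C = (\<lambda>j. (u j, - v j)) ` {..<i}"
  define S where "S = {z. \<forall>c\<in>span C. orthogonal c z}"
  have S: "subspace S"
    unfolding S_def subspace_def by (auto simp: orthogonal_def inner_add_right)
  have "dim S + dim (span C) = DIM((real ^ 'm) \<times> (real ^ 'n))"
    using dim_subspace_orthogonal_to_vectors[OF subspace_span subspace_UNIV, of C] S_def by simp
  moreover have "dim (span C) \<le> card C"
    using dim_le_card[OF span_superset, of C] by (simp add: dim_span C_def)
  moreover have "card C \<le> i" using card_image_le[of "{..<i}"] by (simp add: C_def)
  ultimately have dim: "CARD('m) + CARD('n) \<le> dim S + i" by simp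
  have u: "orthonormal_upto CARD('m) u" and v: "orthonormal_upto CARD('m) v"
    using Z by (auto simp: svd_def)
  have "- s i * (z \<bullet> z) \<le> z \<bullet> dilation Z z" if z: "z \<in> S" for z
  proof -
    obtain x y where xy: "z = (x, y)" by (cases z)
    have eq: "x \<bullet> u j = y \<bullet> v j" if "j < i" for j
    proof -
      have "(u j, - v j) \<in> C" using that by (simp add: C_def)
      then have "orthogonal (u j, - v j) z" using z span_base by (auto simp: S_def)
      then show ?thesis by (simp add: orthogonal_def xy inner_commute)
    qed
    have "z \<bullet> dilation Z z = (\<Sum>j<CARD('m). s j * (2 * (x \<bullet> u j) * (y \<bullet> v j)))"
      by (simp add: inner_dilation xy svd_mult_vec[OF Z] inner_sum_right sum_distrib_left
          inner_commute mult_ac flip: sum.distrib)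
    also have "\<dots> \<ge> (\<Sum>j<CARD('m). - s i * ((x \<bullet> u j)\<^sup>2 + (y \<bullet> v j)\<^sup>2))"
    proof (rule sum_mono)
      fix j
      let ?a = "x \<bullet> u j" and ?b = "y \<bullet> v j"
      show "- s i * (?a\<^sup>2 + ?b\<^sup>2) \<le> s j * (2 * ?a * ?b)"
      proof (cases "j < i")
        case True
        have "- s i * (?a\<^sup>2 + ?b\<^sup>2) \<le> 0" using svd_nonneg[OF Z, of i] by simp
        also have "0 \<le> s j * (2 * ?a * ?b)" using eq[OF True] svd_nonneg[OF Z, of j] by simp
        finally show ?thesis .
      next
        case False
        have "- (2 * ?a * ?b) \<le> ?a\<^sup>2 + ?b\<^sup>2"
          using zero_le_power2[of "?a + ?b"] by (simp add: power2_sum)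
        then have "s j * - (2 * ?a * ?b) \<le> s j * (?a\<^sup>2 + ?b\<^sup>2)"
          using svd_nonneg[OF Z, of j] by (rule mult_left_mono)
        also have "\<dots> \<le> s i * (?a\<^sup>2 + ?b\<^sup>2)"
          using svd_decreasing[OF Z, of i j] False by (intro mult_right_mono) auto
        finally show ?thesis by simp
      qed
    qed
    also have "(\<Sum>j<CARD('m). - s i * ((x \<bullet> u j)\<^sup>2 + (y \<bullet> v j)\<^sup>2))
        = - s i * ((\<Sum>j<CARD('m). (x \<bullet> u j)\<^sup>2) + (\<Sum>j<CARD('m). (y \<bullet> v j)\<^sup>2))"
      by (simp only: sum_distrib_left[symmetric] sum.distrib)
    also have "\<dots> \<ge> - s i * (x \<bullet> x + y \<bullet> y)"
      using svd_nonneg[OF Z, of i] orthonormal_upto_bessel[OF u, of x] orthonormal_upto_bessel[OF v, of y]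
      by (simp add: mult_left_mono)
    finally show ?thesis by (simp add: xy)
  qed
  then show thesis using that S dim by blast
qed

section \<open>Rank-one perturbations\<close>

text \<open>With \<open>w = (a, b) / sqrt 2\<close> and \<open>w' = (a, - b) / sqrt 2\<close>, the dilation \<open>H\<close>, whose nonzero
  eigenvalues are plus and minus the singular values, satisfies
  \<open>H(Z + c a b\<^sup>T) + c w' w'\<^sup>T = H(Z) + c w w\<^sup>T\<close>.  Hence the eigenvalues of this operator dominate
  those of both dilations, while its trace is only \<open>c\<close>.\<close>

lemma singular_values_rank_one_sum:
  fixes Z :: "real ^ 'n ^ 'm"
  assumes mn: "CARD('m) \<le> CARD('n)" and Z: "svd Z u v s"
    and Y: "svd (Z + c *\<^sub>R outer a b) u' v' s'" and c: "0 \<le> c" and a: "norm a = 1" and b: "norm b = 1"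
  shows "(\<Sum>i<CARD('m). \<bar>s i - s' i\<bar>) \<le> c"
proof -
  let ?m = "CARD('m)" and ?n = "CARD('n)"
  let ?Y = "Z + c *\<^sub>R outer a b"
  define w :: "(real ^ 'm) \<times> (real ^ 'n)" where "w = (a, b) /\<^sub>R sqrt 2"
  define T where "T = (\<lambda>z. dilation Z z + (c * (w \<bullet> z)) *\<^sub>R w)"
  have T: "linear T"
    unfolding T_def
    by (intro linear_compose_add linear_dilation linearI)
      (simp_all add: inner_add_right algebra_simps)
  have sym: "T x \<bullet> y = x \<bullet> T y" for x y
  proof -
    have "T x \<bullet> y = y \<bullet> dilation Z x + c * (w \<bullet> x) * (w \<bullet> y)"
      by (simp add: T_def inner_add_right inner_commute[of _ y])
    moreover have "x \<bullet> T y = x \<bullet> dilation Z y + c * (w \<bullet> y) * (w \<bullet> x)"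
      by (simp add: T_def inner_add_right inner_commute[of x w])
    moreover have "y \<bullet> dilation Z x = x \<bullet> dilation Z y" by (simp add: inner_dilation)
    ultimately show ?thesis by simp
  qed
  obtain e l where es: "eigensystem T e l" using spectral_theorem[OF T sym] by blast
  have wz: "(w \<bullet> z)\<^sup>2 = (a \<bullet> fst z + b \<bullet> snd z)\<^sup>2 / 2" for z
    by (cases z) (simp add: w_def power_mult_distrib power_divide field_simps)
  have TZ: "z \<bullet> T z = z \<bullet> dilation Z z + c / 2 * (a \<bullet> fst z + b \<bullet> snd z)\<^sup>2" for z
  proof -
    have "z \<bullet> T z = z \<bullet> dilation Z z + c * (w \<bullet> z)\<^sup>2"
      by (simp add: T_def inner_add_right power2_eq_square inner_commute)
    then show ?thesis by (simp add: wz)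
  qed
  have TY: "z \<bullet> T z = z \<bullet> dilation ?Y z + c / 2 * (a \<bullet> fst z - b \<bullet> snd z)\<^sup>2" for z
  proof -
    have "?Y *v snd z = Z *v snd z + (c * (b \<bullet> snd z)) *\<^sub>R a"
      by (simp add: matrix_vector_mult_add_rdistrib outer_mult_vec flip: scaleR_matrix_vector_assoc)
    then have "z \<bullet> dilation ?Y z = z \<bullet> dilation Z z + 2 * c * (a \<bullet> fst z) * (b \<bullet> snd z)"
      by (simp add: inner_dilation inner_add_right inner_commute)
    then show ?thesis unfolding TZ by (simp add: power2_eq_square algebra_simps)
  qed
  have TZ_ge: "z \<bullet> dilation Z z \<le> z \<bullet> T z" for z using TZ[of z] c by simp
  have TY_ge: "z \<bullet> dilation ?Y z \<le> z \<bullet> T z" for z using TY[of z] c by simp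
  have top: "t i \<le> l i" if X: "svd X x y t" and le: "\<And>z. z \<bullet> dilation X z \<le> z \<bullet> T z"
    and i: "i < ?m" for X x y t i
  proof -
    obtain S where S: "subspace S" "i < dim S" "\<And>z. z \<in> S \<Longrightarrow> t i * (z \<bullet> z) \<le> z \<bullet> dilation X z"
      using dilation_lower_top[OF X i] by blast
    show ?thesis
    proof (rule courant_fischer_lower[OF T es S(1,2)])
      show "t i * (z \<bullet> z) \<le> z \<bullet> T z" if "z \<in> S" for z using S(3)[OF that] le[of z] by linarith
    qed
  qed
  \<comment> \<open>Used with \<open>j = ?m + ?n - Suc i\<close> for the lowest \<open>?m\<close>
    eigenvalues, and with \<open>i = ?m\<close>, where the singular value is 0, to see that the
    middle ones are nonnegative.\<close>
  have bottom: "- t i \<le> l j" if X: "svd X x y t" and le: "\<And>z. z \<bullet> dilation X z \<le> z \<bullet> T z"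
    and i: "i \<le> ?m" and j: "j + i < ?m + ?n" for X x y t i j
  proof -
    obtain S where S: "subspace S" "?m + ?n \<le> dim S + i"
      "\<And>z. z \<in> S \<Longrightarrow> - t i * (z \<bullet> z) \<le> z \<bullet> dilation X z"
      using dilation_lower_bottom[OF X i] by blast
    show ?thesis
    proof (rule courant_fischer_lower[OF T es S(1)])
      show "j < dim S" using S(2) j by simp
      show "- t i * (z \<bullet> z) \<le> z \<bullet> T z" if "z \<in> S" for z using S(3)[OF that] le[of z] by linarith
    qed
  qed
  \<comment> \<open>The dilation has trace 0, because every basis vector of the product has a zero
    component; the added term contributes \<open>c\<close> times the squared length of the unit
    vector \<open>w\<close>.\<close>
  have "(\<Sum>j<?m + ?n. l j) = c"
  proof -
    have "w \<bullet> w = 1" using a b by (simp add: w_def norm_eq_1 field_simps)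
    moreover have "(\<Sum>z\<in>Basis. z \<bullet> dilation Z z) = 0"
      by (rule sum.neutral) (auto simp: Basis_prod_def inner_dilation)
    moreover have "(\<Sum>z\<in>Basis. c * (w \<bullet> z) * (w \<bullet> z)) = c * (w \<bullet> w)"
      by (subst (3) euclidean_inner) (simp add: sum_distrib_left mult.assoc)
    moreover have "z \<bullet> T z = z \<bullet> dilation Z z + c * (w \<bullet> z) * (w \<bullet> z)" for z
      by (simp add: T_def inner_add_right inner_commute)
    ultimately have "(\<Sum>z\<in>Basis. z \<bullet> T z) = c" by (simp add: sum.distrib)
    then show ?thesis using trace_eq_sum_eigenvalues[OF T es] by simp
  qed
  \<comment> \<open>Pairing the top and bottom eigenvalues leaves maximum minus minimum of
    \<open>s i\<close> and \<open>s' i\<close>, that is, their distance.\<close>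
  moreover have "(\<Sum>j<?m + ?n. l j)
      = (\<Sum>j<?m. l j) + (\<Sum>j\<in>{?m..<?n}. l j) + (\<Sum>j\<in>{?n..<?m + ?n}. l j)"
    using mn by (simp add: lessThan_atLeast0 sum.atLeastLessThan_concat)
  moreover have "(\<Sum>j\<in>{?n..<?m + ?n}. l j) = (\<Sum>i<?m. l (?m + ?n - Suc i))"
    by (rule sum.reindex_bij_witness[of _ "\<lambda>i. ?m + ?n - Suc i" "\<lambda>i. ?m + ?n - Suc i"]) auto
  moreover have "0 \<le> (\<Sum>j\<in>{?m..<?n}. l j)"
  proof (rule sum_nonneg)
    fix j assume "j \<in> {?m..<?n}"
    then show "0 \<le> l j" using bottom[OF Z TZ_ge, of ?m j] Z by (simp add: svd_def)
  qed
  moreover have "(\<Sum>i<?m. max (s i) (s' i)) \<le> (\<Sum>j<?m. l j)"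
    using top[OF Z TZ_ge] top[OF Y TY_ge] by (intro sum_mono) auto
  moreover have "(\<Sum>i<?m. max (- s i) (- s' i)) \<le> (\<Sum>i<?m. l (?m + ?n - Suc i))"
    using bottom[OF Z TZ_ge] bottom[OF Y TY_ge] by (intro sum_mono) auto
  ultimately have "(\<Sum>i<?m. max (s i) (s' i)) + (\<Sum>i<?m. max (- s i) (- s' i)) \<le> c" by linarith
  moreover have "\<bar>s i - s' i\<bar> = max (s i) (s' i) + max (- s i) (- s' i)" for i by linarith
  ultimately show ?thesis by (simp add: sum.distrib)
qed

section \<open>Interlacing under a rank-one change\<close>

text \<open>Only the coefficients \<open>s j\<close> with \<open>j \<ge> i\<close> act on such an
  \<open>x\<close>. The family \<open>v\<close> need not span the whole space, hence Bessel's
  inequality rather than Parseval's identity.\<close>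

lemma norm_svd_mult_le:
  fixes Z :: "real ^ 'n ^ 'm"
  assumes Z: "svd Z u v s" and x: "\<And>j. j < i \<Longrightarrow> v j \<bullet> x = 0"
  shows "norm (Z *v x) \<le> s i * norm x"
proof -
  have u: "orthonormal_upto CARD('m) u" and v: "orthonormal_upto CARD('m) v"
    using Z by (auto simp: svd_def)
  have "(norm (Z *v x))\<^sup>2 = (\<Sum>j<CARD('m). (s j * (v j \<bullet> x)) * (s j * (v j \<bullet> x)))"
    unfolding power2_norm_eq_inner svd_mult_vec[OF Z] by (rule orthonormal_upto_inner_sum[OF u])
  also have "\<dots> \<le> (\<Sum>j<CARD('m). (s i)\<^sup>2 * (x \<bullet> v j)\<^sup>2)"
  proof (rule sum_mono)
    fix j
    show "(s j * (v j \<bullet> x)) * (s j * (v j \<bullet> x)) \<le> (s i)\<^sup>2 * (x \<bullet> v j)\<^sup>2"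
    proof (cases "j < i")
      case False
      then have "(s j)\<^sup>2 \<le> (s i)\<^sup>2"
        using svd_decreasing[OF Z, of i j] svd_nonneg[OF Z, of j] by (intro power_mono) auto
      then have "(s j)\<^sup>2 * (x \<bullet> v j)\<^sup>2 \<le> (s i)\<^sup>2 * (x \<bullet> v j)\<^sup>2" by (rule mult_right_mono) simp
      then show ?thesis by (simp add: power2_eq_square inner_commute mult_ac)
    qed (simp add: x)
  qed
  also have "\<dots> \<le> (s i)\<^sup>2 * (x \<bullet> x)"
    using orthonormal_upto_bessel[OF v] by (simp add: mult_left_mono flip: sum_distrib_left)
  also have "\<dots> = (s i * norm x)\<^sup>2" by (simp add: power_mult_distrib power2_norm_eq_inner)
  finally show ?thesis
    by (rule power2_le_imp_le) (simp add: svd_nonneg[OF Z])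
qed

lemma norm_svd_mult_ge:
  fixes Y :: "real ^ 'n ^ 'm"
  assumes Y: "svd Y u v s" and i: "i < CARD('m)" and x: "x \<in> span (v ` {..<Suc i})"
  shows "s i * norm x \<le> norm (Y *v x)"
proof -
  have u: "orthonormal_upto (Suc i) u" and v: "orthonormal_upto (Suc i) v"
    using Y i by (auto simp: svd_def intro: orthonormal_upto_mono)
  define a where "a = (\<lambda>j. x \<bullet> v j)"
  have xa: "x = (\<Sum>j<Suc i. a j *\<^sub>R v j)"
    unfolding a_def by (rule orthonormal_upto_expand_span[OF v x])
  have "Y *v x = (\<Sum>j<Suc i. a j *\<^sub>R (Y *v v j))"
    by (subst xa) (simp only: linear_sum[OF matrix_vector_mul_linear] linear_cmul[OF matrix_vector_mul_linear])
  also have "\<dots> = (\<Sum>j<Suc i. (a j * s j) *\<^sub>R u j)"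
    by (intro sum.cong refl) (use svd_right_vector[OF Y] i in simp)
  finally have "(norm (Y *v x))\<^sup>2 = (\<Sum>j<Suc i. (a j * s j) * (a j * s j))"
    unfolding power2_norm_eq_inner using orthonormal_upto_inner_sum[OF u] by simp
  also have "\<dots> \<ge> (\<Sum>j<Suc i. (s i)\<^sup>2 * (a j * a j))"
  proof (rule sum_mono)
    fix j assume "j \<in> {..<Suc i}"
    then have "(s i)\<^sup>2 \<le> (s j)\<^sup>2"
      using svd_decreasing[OF Y, of j i] svd_nonneg[OF Y, of i] by (intro power_mono) auto
    then have "(s i)\<^sup>2 * (a j * a j) \<le> (s j)\<^sup>2 * (a j * a j)" by (rule mult_right_mono) simp
    then show "(s i)\<^sup>2 * (a j * a j) \<le> (a j * s j) * (a j * s j)"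
      by (simp add: power2_eq_square mult_ac)
  qed
  also have "(\<Sum>j<Suc i. (s i)\<^sup>2 * (a j * a j)) = (s i)\<^sup>2 * (x \<bullet> x)"
    using orthonormal_upto_inner_sum[OF v, of a a] xa by (simp add: sum_distrib_left del: sum.lessThan_Suc)
  also have "\<dots> = (s i * norm x)\<^sup>2" by (simp add: power_mult_distrib power2_norm_eq_inner)
  finally show ?thesis by (rule power2_le_imp_le) simp
qed

text \<open>Among the combinations of the first \<open>i + 2\<close> right singular vectors of
  \<open>Y\<close>, the \<open>i + 1\<close> conditions of orthogonality to \<open>b\<close> and to
  the first \<open>i\<close> right singular vectors of \<open>Z\<close> leave a unit vector
  \<open>x\<close>. At \<open>x\<close> both matrices agree, and the norm of the image is at least
  \<open>s' (Suc i)\<close> and at most \<open>s i\<close>.\<close>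

lemma singular_values_interlace:
  fixes Z :: "real ^ 'n ^ 'm"
  assumes Z: "svd Z u v s" and Y: "svd Y u' v' s'" and eq: "\<And>x. b \<bullet> x = 0 \<Longrightarrow> Y *v x = Z *v x"
  shows "s' (Suc i) \<le> s i"
proof (cases "Suc i < CARD('m)")
  case False
  then show ?thesis using Y svd_nonneg[OF Z] by (simp add: svd_def)
next
  case True
  have v': "orthonormal_upto (Suc (Suc i)) v'"
    using Y True by (auto simp: svd_def intro: orthonormal_upto_mono)
  let ?C = "insert b (v ` {..<i})"
  have "card ?C \<le> Suc i"
    by (metis card_image_le card_insert_le_m1 card_lessThan diff_Suc_1 finite_lessThan zero_less_Suc)
  then have "card ?C < dim (span (v' ` {..<Suc (Suc i)}))"
    using orthonormal_upto_dim_span[OF v'] by simp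
  then obtain x where x: "x \<in> span (v' ` {..<Suc (Suc i)})" "norm x = 1" "\<And>c. c \<in> ?C \<Longrightarrow> c \<bullet> x = 0"
    using exists_unit_orthogonal[of "span (v' ` {..<Suc (Suc i)})" ?C] by auto
  have "s' (Suc i) \<le> norm (Y *v x)" using norm_svd_mult_ge[OF Y True x(1)] x(2) by simp
  also have "Y *v x = Z *v x" using x(3) by (intro eq) simp
  also have "norm (Z *v x) \<le> s i" using norm_svd_mult_le[OF Z, of i x] x by simp
  finally show ?thesis .
qed

section \<open>Concavity of powers\<close>

text \<open>For fixed \<open>d\<close> the increment has derivative
  \<open>p * (t + d) powr (p - 1) - p * t powr (p - 1)\<close>, which is nonpositive. Only interior
  points are differentiated, so \<open>x = 0\<close> is allowed.\<close>

lemma powr_increment_antimono: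
  fixes p :: real
  assumes "0 < p" "p \<le> 1" "0 \<le> x" "x \<le> y" "0 \<le> d"
  shows "(y + d) powr p - y powr p \<le> (x + d) powr p - x powr p"
proof (cases "x = y \<or> d = 0")
  case True
  then show ?thesis by auto
next
  case False
  then have xy: "x < y" and d: "0 < d" using assms by auto
  define f where "f = (\<lambda>t. (t + d) powr p - t powr p)"
  have cont: "continuous_on {x..y} f"
    unfolding f_def using assms by (intro continuous_on_diff continuous_on_powr' continuous_intros) auto
  have "f y \<le> f x"
  proof (rule DERIV_nonpos_imp_decreasing_open[OF less_imp_le[OF xy] _ cont])
    fix t assume t: "x < t" "t < y"
    then have t0: "0 < t" using assms by simp
    have "(f has_real_derivative (p * (t + d) powr (p - 1) - p * t powr (p - 1))) (at t)"
      unfolding f_def using t0 d by (auto intro!: derivative_eq_intros)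
    moreover have "(t + d) powr (p - 1) \<le> t powr (p - 1)"
      using t0 d assms by (intro powr_mono2') auto
    ultimately show "\<exists>D. (f has_real_derivative D) (at t) \<and> D \<le> 0"
      using assms by (intro exI conjI) (auto intro: mult_left_mono)
  qed
  then show ?thesis by (simp add: f_def)
qed

text \<open>The increments of a concave function over disjoint intervals only grow when the intervals
  are pushed together next to \<open>0\<close>.\<close>

lemma sum_powr_increments_le:
  fixes lo hi :: "nat \<Rightarrow> real"
  assumes p: "0 < p" "p \<le> 1"
    and lo: "\<And>i. 0 \<le> lo i" "\<And>i. lo i \<le> hi i" and sep: "\<And>i. hi (Suc i) \<le> lo i"
  shows "(\<Sum>i<n. hi i powr p - lo i powr p) \<le> (\<Sum>i<n. hi i - lo i) powr p"
proof -
  \<comment> \<open>The induction adds intervals from the one nearest to 0 upwards, that is, by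
    decreasing index. The first conjunct says that the lengths laid end to end from 0 do not reach
    past the original intervals, so the next interval can be pushed down to start at
    \<open>?L\<close>.\<close>
  have "(\<Sum>i\<in>{n - k..<n}. hi i - lo i) \<le> hi (n - k) \<and>
    (\<Sum>i\<in>{n - k..<n}. hi i powr p - lo i powr p) \<le> (\<Sum>i\<in>{n - k..<n}. hi i - lo i) powr p"
    if "k \<le> n" for k
    using that
  proof (induction k)
    case 0
    show ?case using lo[of n] by simp
  next
    case (Suc k)
    define j where "j = n - Suc k"
    have j: "n - k = Suc j" "j < n" using Suc.prems by (auto simp: j_def)
    let ?L = "\<Sum>i\<in>{Suc j..<n}. hi i - lo i"
    have IH: "?L \<le> hi (Suc j)"
      "(\<Sum>i\<in>{Suc j..<n}. hi i powr p - lo i powr p) \<le> ?L powr p"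
      using Suc j by auto
    have L: "?L \<le> lo j" using IH(1) sep[of j] by simp
    have L0: "0 \<le> ?L" using lo by (intro sum_nonneg) simp
    have "hi j powr p - lo j powr p \<le> (?L + (hi j - lo j)) powr p - ?L powr p"
      using powr_increment_antimono[OF p L0 L, of "hi j - lo j"] lo[of j] by simp
    then show ?case
      unfolding j_def[symmetric] using IH(2) L j by (simp add: sum.atLeast_Suc_lessThan add.commute)
  qed
  from this[of n] show ?thesis by (simp add: atLeast0LessThan)
qed

lemma singular_values_rank_one_powr:
  fixes Z :: "real ^ 'n ^ 'm"
  assumes p: "0 < p" "p \<le> 1" and mn: "CARD('m) \<le> CARD('n)" and Z: "svd Z u v s"
    and Y: "svd (Z + c *\<^sub>R outer a b) u' v' s'" and c: "0 \<le> c" and a: "norm a = 1" and b: "norm b = 1"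
  shows "(\<Sum>i<CARD('m). \<bar>s i powr p - s' i powr p\<bar>) \<le> c powr p"
proof -
  define lo where "lo = (\<lambda>i. min (s i) (s' i))"
  define hi where "hi = (\<lambda>i. max (s i) (s' i))"
  have eq: "(Z + c *\<^sub>R outer a b) *v x = Z *v x" if "b \<bullet> x = 0" for x
    using that by (simp add: matrix_vector_mult_add_rdistrib outer_mult_vec flip: scaleR_matrix_vector_assoc)
  \<comment> \<open>Four comparisons: two come from the decreasing order of each sequence, two from
    interlacing in both directions.\<close>
  have "hi (Suc i) \<le> lo i" for i
    using singular_values_interlace[OF Z Y, of b i] singular_values_interlace[OF Y Z, of b i] eq
      svd_decreasing[OF Z, of i "Suc i"] svd_decreasing[OF Y, of i "Suc i"]
    by (auto simp: hi_def lo_def)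
  moreover have "0 \<le> lo i" "lo i \<le> hi i" for i
    using svd_nonneg[OF Z, of i] svd_nonneg[OF Y, of i] by (auto simp: hi_def lo_def)
  ultimately have "(\<Sum>i<CARD('m). hi i powr p - lo i powr p) \<le> (\<Sum>i<CARD('m). hi i - lo i) powr p"
    by (intro sum_powr_increments_le[OF p])
  also have "(\<Sum>i<CARD('m). hi i - lo i) \<le> c"
  proof -
    have "hi i - lo i = \<bar>s i - s' i\<bar>" for i by (simp add: hi_def lo_def)
    then show ?thesis using singular_values_rank_one_sum[OF mn Z Y c a b] by simp
  qed
  then have "(\<Sum>i<CARD('m). hi i - lo i) powr p \<le> c powr p"
    using \<open>\<And>i. lo i \<le> hi i\<close> p by (intro powr_mono2) (auto intro: sum_nonneg)
  also have "(\<Sum>i<CARD('m). hi i powr p - lo i powr p) = (\<Sum>i<CARD('m). \<bar>s i powr p - s' i powr p\<bar>)"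
  proof (rule sum.cong[OF refl])
    fix i
    have "0 \<le> s i" "0 \<le> s' i" using svd_nonneg[OF Z] svd_nonneg[OF Y] by auto
    then show "hi i powr p - lo i powr p = \<bar>s i powr p - s' i powr p\<bar>"
      using powr_mono2[of p "s i" "s' i"] powr_mono2[of p "s' i" "s i"] p
      by (cases "s i \<le> s' i") (auto simp: hi_def lo_def max_def min_def)
  qed
  finally show ?thesis .
qed

theorem singular_value_perturbation:
  fixes Y Z :: "real ^ 'n ^ 'm"
  assumes p: "0 < p" "p \<le> 1" and mn: "CARD('m) \<le> CARD('n)"
    and Y: "svd Y u s1 a" and Z: "svd Z v s2 b" and D: "svd (Y - Z) w s3 d"
  shows "(\<Sum>i<CARD('m). \<bar>a i powr p - b i powr p\<bar>) \<le> (\<Sum>i<CARD('m). d i powr p)"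
proof -
  have w: "norm (w i) = 1" "norm (s3 i) = 1" if "i < CARD('m)" for i
    using D that by (auto simp: svd_def intro: orthonormal_upto_norm)
  have *: "(\<Sum>i<CARD('m). \<bar>a' i powr p - b i powr p\<bar>) \<le> (\<Sum>i<q. d i powr p)"
    if "q \<le> CARD('m)" "svd (Z + (\<Sum>j<q. d j *\<^sub>R outer (w j) (s3 j))) x y a'" for q x y a'
    using that
  proof (induction q arbitrary: x y a')
    case 0
    \<comment> \<open>Both \<open>a'\<close> and \<open>b\<close> now belong to \<open>Z\<close>. A
      rank-one change with coefficient 0 shows that they agree, since
      \<open>0 powr p = 0\<close>.\<close>
    have "svd (Z + 0 *\<^sub>R outer (w 0) (s3 0)) x y a'" using 0 by simp
    from singular_values_rank_one_powr[OF p mn Z this] w[of 0]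
    show ?case by (simp add: abs_minus_commute)
  next
    case (Suc q)
    obtain x' y' a'' where q: "svd (Z + (\<Sum>j<q. d j *\<^sub>R outer (w j) (s3 j))) x' y' a''"
      using svd_exists[OF mn] by blast
    have IH: "(\<Sum>i<CARD('m). \<bar>a'' i powr p - b i powr p\<bar>) \<le> (\<Sum>i<q. d i powr p)"
      using Suc.IH[OF _ q] Suc.prems by simp
    have "svd ((Z + (\<Sum>j<q. d j *\<^sub>R outer (w j) (s3 j))) + d q *\<^sub>R outer (w q) (s3 q)) x y a'"
      using Suc.prems by (simp add: add.assoc)
    then have "(\<Sum>i<CARD('m). \<bar>a'' i powr p - a' i powr p\<bar>) \<le> d q powr p"
      using singular_values_rank_one_powr[OF p mn q] w svd_nonneg[OF D] Suc.prems by simp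
    moreover have "(\<Sum>i<CARD('m). \<bar>a' i powr p - b i powr p\<bar>)
        \<le> (\<Sum>i<CARD('m). \<bar>a'' i powr p - a' i powr p\<bar> + \<bar>a'' i powr p - b i powr p\<bar>)"
      by (intro sum_mono) linarith
    ultimately show ?case using IH by (simp add: sum.distrib)
  qed
  have "Y = Z + (\<Sum>j<CARD('m). d j *\<^sub>R outer (w j) (s3 j))"
    using D by (simp add: svd_def algebra_simps)
  then show ?thesis using *[of "CARD('m)"] Y by auto
qed

section \<open>Schatten quasi-norms and the null space property\<close>

lemma poly_det: "poly (det M) x = det (\<chi> i j. poly (M $ i $ j) x)"
  for M :: "real poly ^ 'm ^ 'm"
  by (simp add: det_def poly_sum poly_prod)

text \<open>Conjugation by the orthogonal matrix of left singular vectors diagonalises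
  \<open>x *\<^sub>R mat 1 - X ** transpose X\<close>. Polynomial identity is checked at every real
  \<open>x\<close>.\<close>

lemma char_poly_svd:
  fixes X :: "real ^ 'n ^ 'm"
  assumes X: "svd X u v s"
  shows "char_poly_mat (X ** transpose X) = (\<Prod>i<CARD('m). [:- (s i)\<^sup>2, 1:])"
proof (rule poly_eq_poly_eq_iff[THEN iffD1], rule ext)
  fix x
  let ?M = "X ** transpose X"
  have u: "orthonormal_upto CARD('m) u" using X by (simp add: svd_def)
  \<comment> \<open>A numbering of the matrix indices, since determinants run over the type
    \<open>'m\<close> and singular vectors over natural numbers.\<close>
  obtain \<phi> :: "'m \<Rightarrow> nat" where \<phi>: "bij_betw \<phi> UNIV {..<CARD('m)}"
    using ex_bij_betw_finite_nat[of "UNIV :: 'm set"] by (auto simp: atLeast0LessThan)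
  then have \<phi>m: "\<phi> i < CARD('m)" for i by (auto simp: bij_betw_def)
  have \<phi>inj: "\<phi> i = \<phi> j \<longleftrightarrow> i = j" for i j using \<phi> by (auto simp: bij_betw_def inj_on_def)
  define N where "N = x *\<^sub>R mat 1 - ?M"
  define U :: "real ^ 'm ^ 'm" where "U = (\<chi> i j. u (\<phi> j) $ i)"
  have col: "column j U = u (\<phi> j)" for j by (simp add: column_def U_def vec_eq_iff)
  have UTU: "transpose U ** U = mat 1"
    by (simp add: matrix_matrix_mult_def transpose_def mat_def vec_eq_iff U_def
        inner_vec_def[symmetric, of "u _" "u _", simplified] orthonormal_uptoD[OF u \<phi>m \<phi>m] \<phi>inj)
  have "det U * det U = 1"
    using arg_cong[OF UTU, of det] by (simp add: det_mul)
  have "N *v u (\<phi> j) = (x - (s (\<phi> j))\<^sup>2) *\<^sub>R u (\<phi> j)" for j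
    using svd_left_vector[OF X \<phi>m, of j] svd_right_vector[OF X \<phi>m, of j]
    by (simp add: N_def matrix_vector_mult_diff_rdistrib linear_cmul[OF matrix_vector_mul_linear]
        scaleR_left_diff_distrib power2_eq_square
        flip: matrix_vector_mul_assoc scaleR_matrix_vector_assoc)
  then have NU: "(N ** U) $ i $ j = (x - (s (\<phi> j))\<^sup>2) * u (\<phi> j) $ i" for i j
    by (simp add: vec_eq_iff matrix_vector_mult_def matrix_matrix_mult_def U_def)
  have D: "(transpose U ** (N ** U)) $ i $ j = (if i = j then x - (s (\<phi> i))\<^sup>2 else 0)" for i j
  proof -
    have "(transpose U ** (N ** U)) $ i $ j
        = (x - (s (\<phi> j))\<^sup>2) * (\<Sum>k\<in>UNIV. u (\<phi> i) $ k * u (\<phi> j) $ k)"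
      unfolding matrix_matrix_mult_def[of "transpose U"]
      by (simp add: NU transpose_def) (simp add: U_def sum_distrib_left mult_ac)
    also have "(\<Sum>k\<in>UNIV. u (\<phi> i) $ k * u (\<phi> j) $ k) = u (\<phi> i) \<bullet> u (\<phi> j)"
      by (simp add: inner_vec_def)
    finally show ?thesis using orthonormal_uptoD[OF u \<phi>m \<phi>m, of i j] \<phi>inj by simp
  qed
  have "poly (char_poly_mat ?M) x = det N"
    unfolding char_poly_mat_def poly_det N_def
    by (rule arg_cong[of _ _ det]) (simp add: vec_eq_iff mat_def)
  also have "\<dots> = det (transpose U ** (N ** U))"
    using \<open>det U * det U = 1\<close> by (simp add: det_mul)
  also have "\<dots> = (\<Prod>i\<in>UNIV. x - (s (\<phi> i))\<^sup>2)"
    by (subst det_diagonal) (simp_all add: D)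
  also have "\<dots> = (\<Prod>i<CARD('m). x - (s i)\<^sup>2)"
    by (rule prod.reindex_bij_betw[OF \<phi>])
  also have "\<dots> = poly (\<Prod>i<CARD('m). [:- (s i)\<^sup>2, 1:]) x"
    by (simp add: poly_prod)
  finally show "poly (char_poly_mat ?M) x = poly (\<Prod>i<CARD('m). [:- (s i)\<^sup>2, 1:]) x" .
qed

text \<open>Links the sorted list of the definition to an arbitrary decomposition. The sum does not
  depend on the order, so comparing multisets of roots suffices.\<close>

lemma schatten_pow_svd:
  fixes X :: "real ^ 'n ^ 'm"
  assumes X: "svd X u v s"
  shows "schatten_pow p X = (\<Sum>i<CARD('m). s i powr p)"
proof -
  let ?S = "image_mset s (mset_set {..<CARD('m)})"
  have "proots (char_poly_mat (X ** transpose X)) = (\<Sum>i<CARD('m). {#(s i)\<^sup>2#})"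
    unfolding char_poly_svd[OF X] by (subst proots_prod) simp_all
  also have "\<dots> = image_mset (\<lambda>i. (s i)\<^sup>2) (mset_set {..<CARD('m)})"
    by (simp add: sum_unfold_sum_mset)
  finally have "image_mset sqrt (proots (char_poly_mat (X ** transpose X))) = ?S"
    using svd_nonneg[OF X] by (simp add: multiset.map_comp o_def)
  then have ms: "mset (singular_values X) = ?S"
    by (simp add: singular_values_def)
  then have len: "length (singular_values X) = CARD('m)"
    by (metis size_mset size_image_mset size_mset_set card_lessThan)
  have "schatten_pow p X = (\<Sum>i<CARD('m). (singular_values X ! i) powr p)"
    unfolding schatten_pow_def singular_value_def
    by (rule sum.reindex_bij_witness[of _ Suc "\<lambda>i. i - 1"]) auto
  also have "\<dots> = sum_list (map (\<lambda>t. t powr p) (singular_values X))"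
    by (simp add: sum_list_sum_nth len atLeast0LessThan)
  also have "\<dots> = sum_mset (image_mset (\<lambda>t. t powr p) (mset (singular_values X)))"
    by (metis mset_map sum_mset_sum_list)
  also have "\<dots> = (\<Sum>i<CARD('m). s i powr p)"
    by (simp add: ms multiset.map_comp o_def sum_unfold_sum_mset)
  finally show ?thesis .
qed

text \<open>If \<open>s k\<close> were positive, the \<open>k + 1\<close> orthonormal vectors
  \<open>u 0\<close>, ..., \<open>u k\<close> would all lie in the range of
  \<open>X\<close>.\<close>

lemma rank_le_singular_value_zero:
  fixes X :: "real ^ 'n ^ 'm"
  assumes X: "svd X u v s" and r: "rank X \<le> k"
  shows "s k = 0"
proof (rule ccontr)
  assume "s k \<noteq> 0"
  then have sk: "0 < s k" and k: "k < CARD('m)"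
    using svd_nonneg[OF X, of k] X by (auto simp: svd_def not_le[symmetric])
  have u: "orthonormal_upto (Suc k) u"
    using X k by (auto simp: svd_def intro: orthonormal_upto_mono)
  have "u ` {..<Suc k} \<subseteq> range (\<lambda>x. X *v x)"
  proof clarsimp
    fix i assume "i < Suc k"
    then have "X *v v i = s i *\<^sub>R u i" "s i > 0"
      using svd_right_vector[OF X, of i] svd_decreasing[OF X, of i k] sk k by auto
    then have "u i = X *v (v i /\<^sub>R s i)"
      by (simp add: linear_cmul[OF matrix_vector_mul_linear])
    then show "u i \<in> range (\<lambda>x. X *v x)" by blast
  qed
  then have "dim (u ` {..<Suc k}) \<le> rank X" unfolding rank_dim_range by (rule dim_subset)
  then show False using orthonormal_upto_dim_span[OF u] r by (simp add: dim_span)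
qed

text \<open>For a competitor \<open>W\<close> put \<open>Z = X - W\<close> and apply the
  perturbation inequality to \<open>X\<close> and \<open>Z\<close>, whose difference is
  \<open>W\<close>. As the singular values of \<open>X\<close> vanish from \<open>k\<close> on, the
  left-hand side is at least the power sum of \<open>X\<close>, minus the head of \<open>Z\<close>,
  plus the tail of \<open>Z\<close>.\<close>

theorem null_space_property_imp_recovery:
  fixes A :: "real ^ 'n ^ 'm \<Rightarrow> real ^ 'l"
  assumes A: "linear A" and mn: "CARD('m) \<le> CARD('n)" and p: "0 < p" "p \<le> 1" and k: "k \<le> CARD('m)"
    and nsp: "\<And>Z u v s. A Z = 0 \<Longrightarrow> Z \<noteq> 0 \<Longrightarrow> svd Z u v s
      \<Longrightarrow> (\<Sum>i<k. s i powr p) < (\<Sum>i\<in>{k..<CARD('m)}. s i powr p)"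
    and X: "rank X \<le> k"
  shows "exactly_recovered A p (A X) X"
proof -
  have less: "schatten_pow p X < schatten_pow p W" if W: "A W = A X" "W \<noteq> X" for W
  proof -
    define Z where "Z = X - W"
    obtain u v s where Z: "svd Z u v s" using svd_exists[OF mn] by blast
    obtain u1 v1 s1 where X1: "svd X u1 v1 s1" using svd_exists[OF mn] by blast
    obtain u2 v2 s2 where W2: "svd W u2 v2 s2" using svd_exists[OF mn] by blast
    have "A Z = 0" "Z \<noteq> 0" using W by (auto simp: Z_def linear_diff[OF A])
    then have *: "(\<Sum>i<k. s i powr p) < (\<Sum>i\<in>{k..<CARD('m)}. s i powr p)"
      using nsp Z by blast
    have zero: "s1 i = 0" if "k \<le> i" for i
      using rank_le_singular_value_zero[OF X1 X] svd_decreasing[OF X1 that] svd_nonneg[OF X1, of i]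
      by simp
    have split: "(\<Sum>i<CARD('m). g i) = (\<Sum>i<k. g i) + (\<Sum>i\<in>{k..<CARD('m)}. g i)" for g :: "nat \<Rightarrow> real"
      using k by (simp add: lessThan_atLeast0 sum.atLeastLessThan_concat)
    have "svd (X - Z) u2 v2 s2" using W2 by (simp add: Z_def)
    then have "(\<Sum>i<CARD('m). \<bar>s1 i powr p - s i powr p\<bar>) \<le> (\<Sum>i<CARD('m). s2 i powr p)"
      by (rule singular_value_perturbation[OF p mn X1 Z])
    moreover have "(\<Sum>i<k. s1 i powr p - s i powr p) \<le> (\<Sum>i<k. \<bar>s1 i powr p - s i powr p\<bar>)"
      by (intro sum_mono) simp
    moreover have "(\<Sum>i\<in>{k..<CARD('m)}. \<bar>s1 i powr p - s i powr p\<bar>) = (\<Sum>i\<in>{k..<CARD('m)}. s i powr p)"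
      by (intro sum.cong refl) (simp add: zero)
    moreover have "(\<Sum>i<CARD('m). s1 i powr p) = (\<Sum>i<k. s1 i powr p)"
      using zero by (simp add: split)
    ultimately have "(\<Sum>i<CARD('m). s1 i powr p) < (\<Sum>i<CARD('m). s2 i powr p)"
      using * split[of "\<lambda>i. \<bar>s1 i powr p - s i powr p\<bar>"] by (simp add: sum_subtractf)
    then show ?thesis by (simp add: schatten_pow_svd[OF X1] schatten_pow_svd[OF W2])
  qed
  \<comment> \<open>The strict inequality against every other feasible matrix gives optimality and
    uniqueness at once.\<close>
  show ?thesis
    unfolding exactly_recovered_def optimal_solution_def
    using less by (metis less_eq_real_def not_less)
qed

section \<open>Partial sums of a singular value decomposition\<close>

definition svd_part ::
  "(nat \<Rightarrow> real ^ 'm) \<Rightarrow> (nat \<Rightarrow> real ^ 'n) \<Rightarrow> (nat \<Rightarrow> real) \<Rightarrow> nat set \<Rightarrow> real ^ 'n ^ 'm" where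
  "svd_part u v s I = (\<Sum>i\<in>I. s i *\<^sub>R outer (u i) (v i))"

lemma svd_part_mult_vec: "svd_part u v s I *v x = (\<Sum>i\<in>I. (s i * (v i \<bullet> x)) *\<^sub>R u i)"
  by (simp add: svd_part_def sum_mult_vec outer_mult_vec flip: scaleR_matrix_vector_assoc)

lemma inner_svd_part:
  fixes Z :: "real ^ 'n ^ 'm"
  assumes Z: "svd Z u v s" and "finite I" "finite J"
  shows "svd_part u v s I \<bullet> svd_part u v s J = (\<Sum>i\<in>I \<inter> J. (s i)\<^sup>2)"
proof -
  have *: "s i * (s j * ((u i \<bullet> u j) * (v i \<bullet> v j))) = (if i = j then (s i)\<^sup>2 else 0)" for i j
  proof (cases "i < CARD('m) \<and> j < CARD('m)")
    case True
    then show ?thesis using Z by (simp add: svd_def orthonormal_upto_def power2_eq_square)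
  next
    case False
    then have "s i = 0 \<or> s j = 0" using Z by (auto simp: svd_def)
    then show ?thesis by auto
  qed
  have "svd_part u v s I \<bullet> svd_part u v s J
      = (\<Sum>i\<in>I. \<Sum>j\<in>J. s i * (s j * ((u i \<bullet> u j) * (v i \<bullet> v j))))"
    unfolding svd_part_def inner_sum_left unfolding inner_sum_right
    by (simp add: inner_outer mult_ac)
  also have "\<dots> = (\<Sum>i\<in>I. if i \<in> J then (s i)\<^sup>2 else 0)"
    using assms(3) by (simp add: *)
  also have "\<dots> = (\<Sum>i\<in>I \<inter> J. (s i)\<^sup>2)"
    using assms(2) by (simp add: sum.inter_restrict)
  finally show ?thesis .
qed

lemma norm_svd_part:
  assumes Z: "svd Z u v s" and "finite I"
  shows "(norm (svd_part u v s I))\<^sup>2 = (\<Sum>i\<in>I. (s i)\<^sup>2)"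
  using inner_svd_part[OF Z assms(2,2)] by (simp add: power2_norm_eq_inner)

lemma rank_le_card:
  fixes X :: "real ^ 'n ^ 'm"
  assumes "finite C" "\<And>x. X *v x \<in> span C"
  shows "rank X \<le> card C"
proof -
  have "range (\<lambda>x. X *v x) \<subseteq> span C" using assms(2) by blast
  then show ?thesis unfolding rank_dim_range using dim_le_card \<open>finite C\<close> by blast
qed

text \<open>The range lies in the span of the \<open>u i\<close> with
  \<open>i \<in> I \<union> J\<close>. Combinations of two parts are what polarisation of the
  restricted isometry bounds requires.\<close>

lemma rank_svd_part_combination:
  assumes "finite I" "finite J"
  shows "rank (a *\<^sub>R svd_part u v s I + b *\<^sub>R svd_part u v s J) \<le> card (I \<union> J)"
proof -
  have "rank (a *\<^sub>R svd_part u v s I + b *\<^sub>R svd_part u v s J) \<le> card (u ` (I \<union> J))"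
  proof (rule rank_le_card)
    fix x
    show "(a *\<^sub>R svd_part u v s I + b *\<^sub>R svd_part u v s J) *v x \<in> span (u ` (I \<union> J))"
      unfolding matrix_vector_mult_add_rdistrib scaleR_matrix_vector_assoc[symmetric] svd_part_mult_vec
      by (intro span_add span_scale span_sum) (auto intro: span_base)
  qed (use assms in simp)
  also have "\<dots> \<le> card (I \<union> J)" using assms by (simp add: card_image_le)
  finally show ?thesis .
qed

lemma rank_svd_part: "finite I \<Longrightarrow> rank (svd_part u v s I) \<le> card I"
  using rank_svd_part_combination[of I I 1 u v s 0] by simp

section \<open>Blocks of consecutive indices\<close>

definition block :: "nat \<Rightarrow> nat \<Rightarrow> nat \<Rightarrow> nat set" where
  "block c q j = {c + j * q..<c + j * q + q}"

lemma finite_block [simp]: "finite (block c q j)"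
  and card_block [simp]: "card (block c q j) = q"
  by (simp_all add: block_def)

lemma block_Suc: "block c q (Suc j) = block (c + q) q j"
  by (simp add: block_def algebra_simps)

lemma block_disjoint:
  assumes "i \<noteq> j"
  shows "block c q i \<inter> block c q j = {}"
proof -
  have "block c q i \<inter> block c q j = {}" if "i < j" for i j
  proof -
    have "Suc i * q \<le> j * q" using that by (intro mult_right_mono) auto
    then show ?thesis by (auto simp: block_def)
  qed
  then show ?thesis using assms by (metis Int_commute linorder_neqE_nat)
qed

lemma sum_blocks:
  fixes g :: "nat \<Rightarrow> 'a::comm_monoid_add"
  shows "(\<Sum>j<n. \<Sum>i\<in>block c q j. g i) = (\<Sum>i\<in>{c..<c + n * q}. g i)"
proof (induction n)
  case (Suc n)
  have "(\<Sum>i\<in>{c..<c + n * q}. g i) + (\<Sum>i\<in>block c q n. g i) = (\<Sum>i\<in>{c..<c + Suc n * q}. g i)"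
    unfolding block_def by (subst sum.atLeastLessThan_concat) (auto simp: algebra_simps)
  then show ?case using Suc by simp
qed simp

text \<open>As \<open>q \<ge> 1\<close>, \<open>CARD('m)\<close> blocks reach past the last index;
  the surplus terms vanish because \<open>s\<close> does.\<close>

lemma svd_block_decomposition:
  fixes Z :: "real ^ 'n ^ 'm"
  assumes Z: "svd Z u v s" and q: "1 \<le> q"
  shows "Z = svd_part u v s {..<c} + (\<Sum>j<CARD('m). svd_part u v s (block c q j))"
proof -
  let ?g = "\<lambda>i. s i *\<^sub>R outer (u i) (v i)"
  have N: "CARD('m) \<le> c + CARD('m) * q" using mult_le_mono2[OF q, of "CARD('m)"] by linarith
  have "(\<Sum>i<CARD('m). ?g i) = (\<Sum>i\<in>{0..<c + CARD('m) * q}. ?g i)"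
    using Z N by (intro sum.mono_neutral_left) (auto simp: svd_def)
  then have "Z = (\<Sum>i\<in>{0..<c + CARD('m) * q}. ?g i)"
    using Z by (simp add: svd_def)
  also have "\<dots> = (\<Sum>i\<in>{0..<c}. ?g i) + (\<Sum>i\<in>{c..<c + CARD('m) * q}. ?g i)"
    by (simp add: sum.atLeastLessThan_concat)
  finally show ?thesis by (simp add: svd_part_def sum_blocks atLeast0LessThan)
qed

lemma sum_singular_values_tail:
  fixes Z :: "real ^ 'n ^ 'm"
  assumes Z: "svd Z u v s" and q: "1 \<le> q" and g: "g 0 = 0"
  shows "(\<Sum>j<CARD('m). \<Sum>i\<in>block c q j. g (s i)) = (\<Sum>i\<in>{c..<CARD('m)}. g (s i))"
proof -
  have N: "CARD('m) \<le> c + CARD('m) * q" using mult_le_mono2[OF q, of "CARD('m)"] by linarith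
  have "(\<Sum>i\<in>{c..<c + CARD('m) * q}. g (s i)) = (\<Sum>i\<in>{c..<CARD('m)}. g (s i))"
    using Z g N by (intro sum.mono_neutral_right) (auto simp: svd_def)
  then show ?thesis by (simp add: sum_blocks)
qed

text \<open>The index \<open>c + q + j * q\<close> opens the block after block \<open>j\<close>, so
  its entry is bounded by each of the \<open>q\<close> entries of block \<open>j\<close>.\<close>

lemma block_head_le_previous:
  assumes s: "\<And>i. 0 \<le> s i" "\<And>i j. i \<le> j \<Longrightarrow> s j \<le> s i" and "0 < p"
  shows "real q * s (c + q + j * q) powr p \<le> (\<Sum>i\<in>block c q j. s i powr p)"
proof -
  have "(\<Sum>i\<in>block c q j. s (c + q + j * q) powr p) \<le> (\<Sum>i\<in>block c q j. s i powr p)"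
    using s \<open>0 < p\<close> by (intro sum_mono powr_mono2) (auto simp: block_def)
  then show ?thesis by simp
qed

lemma power2_powr_half: "0 \<le> x \<Longrightarrow> (x\<^sup>2) powr (p / 2) = x powr p" for x :: real
  by (simp add: powr_powr flip: powr_numeral)

text \<open>A case of Hoelder's inequality. Young's inequality with weights \<open>p / 2\<close> and
  \<open>1 - p / 2\<close> compares each square with their mean \<open>M\<close>; in the sum the
  right-hand side collapses to \<open>card I * M\<close>.\<close>

lemma sum_powr_le_power_mean:
  fixes s :: "'i \<Rightarrow> real"
  assumes p: "0 < p" "p < 2" and s: "\<And>i. i \<in> I \<Longrightarrow> 0 \<le> s i" and I: "finite I"
  shows "(\<Sum>i\<in>I. s i powr p) \<le> real (card I) powr (1 - p / 2) * (\<Sum>i\<in>I. (s i)\<^sup>2) powr (p / 2)"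
proof (cases "(\<Sum>i\<in>I. (s i)\<^sup>2) = 0")
  case True
  then have "s i = 0" if "i \<in> I" for i using that I by (simp add: sum_nonneg_eq_0_iff)
  then show ?thesis by simp
next
  case False
  then have "I \<noteq> {}" by auto
  then have k: "0 < real (card I)" using I by (simp add: card_gt_0_iff)
  have S: "0 < (\<Sum>i\<in>I. (s i)\<^sup>2)" using False by (simp add: less_le sum_nonneg)
  define M where "M = (\<Sum>i\<in>I. (s i)\<^sup>2) / real (card I)"
  have M: "0 < M" using S k by (simp add: M_def)
  have "s i powr p * M powr (1 - p / 2) \<le> p / 2 * (s i)\<^sup>2 + (1 - p / 2) * M" if "i \<in> I" for i
  proof (cases "s i = 0")
    case True
    then show ?thesis using M p by simp
  next
    case False
    then have "0 < s i" using s[OF that] by simp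
    then show ?thesis
      using Youngs_inequality_0[of "p / 2" "1 - p / 2" "(s i)\<^sup>2" M] M p
      by (simp add: powr_powr flip: powr_numeral)
  qed
  then have "(\<Sum>i\<in>I. s i powr p * M powr (1 - p / 2)) \<le> (\<Sum>i\<in>I. p / 2 * (s i)\<^sup>2 + (1 - p / 2) * M)"
    by (rule sum_mono)
  also have "\<dots> = p / 2 * (\<Sum>i\<in>I. (s i)\<^sup>2) + (1 - p / 2) * (real (card I) * M)"
    by (simp add: sum.distrib sum_distrib_left mult_ac)
  also have "\<dots> = real (card I) * M" using k by (simp add: M_def algebra_simps)
  also have "\<dots> = real (card I) * M powr (p / 2) * M powr (1 - p / 2)"
    using M by (simp add: powr_add[symmetric])
  finally have "(\<Sum>i\<in>I. s i powr p) * M powr (1 - p / 2) \<le> real (card I) * M powr (p / 2) * M powr (1 - p / 2)"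
    by (simp add: sum_distrib_right)
  then have "(\<Sum>i\<in>I. s i powr p) \<le> real (card I) * M powr (p / 2)" using M by simp
  also have "\<dots> = real (card I) powr (1 - p / 2) * (\<Sum>i\<in>I. (s i)\<^sup>2) powr (p / 2)"
    using k S by (simp add: M_def powr_divide powr_diff)
  finally show ?thesis .
qed

section \<open>Restricted isometry in the lp quasi-norm\<close>

lemma powr_abs_add_le:
  fixes p :: real
  assumes "0 < p" "p \<le> 1"
  shows "\<bar>a + b\<bar> powr p \<le> \<bar>a\<bar> powr p + \<bar>b\<bar> powr p"
proof -
  have "\<bar>a + b\<bar> powr p \<le> (\<bar>a\<bar> + \<bar>b\<bar>) powr p" using assms by (intro powr_mono2) auto
  also have "\<dots> \<le> \<bar>a\<bar> powr p + \<bar>b\<bar> powr p"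
    using powr_increment_antimono[OF assms, of 0 "\<bar>a\<bar>" "\<bar>b\<bar>"] by simp
  finally show ?thesis .
qed

lemma lp_pow_sum_le:
  assumes "0 < p" "p \<le> 1"
  shows "lp_pow p (\<Sum>j\<in>J. f j) \<le> (\<Sum>j\<in>J. lp_pow p (f j))"
proof (induction J rule: infinite_finite_induct)
  case (insert j J)
  have "lp_pow p (x + y) \<le> lp_pow p x + lp_pow p y" for x y :: "real ^ 'l"
    unfolding lp_pow_def sum.distrib[symmetric]
    by (intro sum_mono) (simp add: powr_abs_add_le[OF assms])
  from this[of "f j" "\<Sum>j\<in>J. f j"] insert show ?case by simp
qed (simp_all add: lp_pow_def)

text \<open>The head has \<open>k + q\<close> singular values, the blocks \<open>q\<close> each.
  Each block is bounded by the power sum of the block before it, so together they are bounded by the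
  tail from \<open>k\<close> on, hence by the first \<open>k\<close> terms if the claim fails. The
  power mean then yields the factor \<open>(k / q) powr (1 - p / 2)\<close>, too small for the lower
  isometry bound on the head.\<close>

lemma lp_rip_imp_null_space_property:
  fixes A :: "real ^ 'n ^ 'm \<Rightarrow> real ^ 'l"
  assumes A: "linear A" and p: "0 < p" "p < 1" and k: "1 \<le> k" and q: "1 \<le> q"
    and upper: "\<And>X. rank X \<le> q \<Longrightarrow> lp_pow p (A X) \<le> (1 + \<beta>1) * norm X powr p"
    and lower: "\<And>X. rank X \<le> k + q \<Longrightarrow> (1 - \<beta>2) * norm X powr p \<le> lp_pow p (A X)"
    and \<beta>1: "0 \<le> \<beta>1" and \<beta>: "(1 + \<beta>1) * (real k / real q) powr (1 - p / 2) < 1 - \<beta>2"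
    and AZ: "A Z = 0" and Z0: "Z \<noteq> 0" and Z: "svd Z u v s"
  shows "(\<Sum>i<k. s i powr p) < (\<Sum>i\<in>{k..<CARD('m)}. s i powr p)"
proof (rule ccontr)
  assume "\<not> ?thesis"
  then have tail: "(\<Sum>i\<in>{k..<CARD('m)}. s i powr p) \<le> (\<Sum>i<k. s i powr p)" by simp
  note s0 = svd_nonneg[OF Z] and dec = svd_decreasing[OF Z]
  let ?h = "svd_part u v s {..<k + q}" and ?b = "\<lambda>j. svd_part u v s (block (k + q) q j)"
  have head: "norm (svd_part u v s {..<k}) \<le> norm ?h"
  proof (rule power2_le_imp_le)
    show "(norm (svd_part u v s {..<k}))\<^sup>2 \<le> (norm ?h)\<^sup>2"
      unfolding norm_svd_part[OF Z finite_lessThan] by (rule sum_mono2) auto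
  qed simp
  have "0 = A (?h + (\<Sum>j<CARD('m). ?b j))"
    using AZ svd_block_decomposition[OF Z q, of "k + q"] by simp
  then have "A ?h = (\<Sum>j<CARD('m). - A (?b j))"
    by (simp add: linear_add[OF A] linear_sum[OF A] sum_negf eq_neg_iff_add_eq_0)
  then have "lp_pow p (A ?h) \<le> (\<Sum>j<CARD('m). lp_pow p (- A (?b j)))"
    using lp_pow_sum_le[of p] p by simp
  also have "\<dots> \<le> (\<Sum>j<CARD('m). (1 + \<beta>1) * (real q powr (p / 2 - 1) * (\<Sum>i\<in>block k q j. s i powr p)))"
  proof (rule sum_mono)
    fix j
    let ?t = "s (k + q + j * q)"
    have "(norm (?b j))\<^sup>2 \<le> (\<Sum>i\<in>block (k + q) q j. ?t\<^sup>2)"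
      unfolding norm_svd_part[OF Z finite_block] using s0 dec
      by (intro sum_mono power_mono) (auto simp: block_def)
    then have "(norm (?b j))\<^sup>2 \<le> (sqrt (real q) * ?t)\<^sup>2" by (simp add: power_mult_distrib)
    then have "norm (?b j) \<le> sqrt (real q) * ?t"
      by (rule power2_le_imp_le) (simp add: s0)
    then have "norm (?b j) powr p \<le> (sqrt (real q) * ?t) powr p"
      using p by (intro powr_mono2) auto
    also have "\<dots> = real q powr (p / 2 - 1) * (real q * ?t powr p)"
      using q s0 by (simp add: powr_mult powr_half_sqrt[symmetric] powr_powr powr_diff)
    also have "\<dots> \<le> real q powr (p / 2 - 1) * (\<Sum>i\<in>block k q j. s i powr p)"
      using block_head_le_previous[of s p q k j] s0 dec p by (intro mult_left_mono) auto
    finally have "(1 + \<beta>1) * norm (?b j) powr p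
        \<le> (1 + \<beta>1) * (real q powr (p / 2 - 1) * (\<Sum>i\<in>block k q j. s i powr p))"
      using \<beta>1 by (intro mult_left_mono) auto
    moreover have "lp_pow p (- A (?b j)) \<le> (1 + \<beta>1) * norm (?b j) powr p"
      using upper[of "?b j"] rank_svd_part[of "block (k + q) q j" u v s] by (simp add: lp_pow_def)
    ultimately show "lp_pow p (- A (?b j))
        \<le> (1 + \<beta>1) * (real q powr (p / 2 - 1) * (\<Sum>i\<in>block k q j. s i powr p))" by simp
  qed
  also have "\<dots> = (1 + \<beta>1) * (real q powr (p / 2 - 1) * (\<Sum>i\<in>{k..<CARD('m)}. s i powr p))"
    using sum_singular_values_tail[OF Z q, of "\<lambda>t. t powr p" k] by (simp flip: sum_distrib_left)
  also have "\<dots> \<le> (1 + \<beta>1) * (real q powr (p / 2 - 1)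
      * (real k powr (1 - p / 2) * (\<Sum>i<k. (s i)\<^sup>2) powr (p / 2)))"
    using tail sum_powr_le_power_mean[of p "{..<k}" s] p s0 \<beta>1
    by (intro mult_left_mono) auto
  also have "(\<Sum>i<k. (s i)\<^sup>2) powr (p / 2) = norm (svd_part u v s {..<k}) powr p"
    unfolding norm_svd_part[OF Z finite_lessThan, symmetric] by (simp add: power2_powr_half)
  also have "(1 + \<beta>1) * (real q powr (p / 2 - 1) * (real k powr (1 - p / 2) * norm (svd_part u v s {..<k}) powr p))
      = (1 + \<beta>1) * (real k / real q) powr (1 - p / 2) * norm (svd_part u v s {..<k}) powr p"
    using powr_minus_divide[of "real q" "1 - p / 2"] by (simp add: powr_divide)
  also have "\<dots> \<le> (1 + \<beta>1) * (real k / real q) powr (1 - p / 2) * norm ?h powr p"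
    using head p \<beta>1 by (intro mult_left_mono powr_mono2) auto
  finally have "lp_pow p (A ?h) \<le> (1 + \<beta>1) * (real k / real q) powr (1 - p / 2) * norm ?h powr p" .
  moreover have "(1 - \<beta>2) * norm ?h powr p \<le> lp_pow p (A ?h)"
    using lower[of ?h] rank_svd_part[of "{..<k + q}" u v s] by simp
  ultimately have "(1 - \<beta>2) * norm ?h powr p \<le> (1 + \<beta>1) * (real k / real q) powr (1 - p / 2) * norm ?h powr p"
    by linarith
  \<comment> \<open>The factor on the left is strictly larger, so only a zero head satisfies the
    inequality; then \<open>s 0 = 0\<close>, and all singular values vanish.\<close>
  then have "norm ?h powr p \<le> 0" using \<beta> by (smt (verit) mult_right_less_imp_less powr_ge_zero mult_le_cancel_right)
  then have "norm ?h = 0" by (metis norm_ge_zero order_antisym powr_eq_0_iff powr_ge_zero)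
  then have "(\<Sum>i<k + q. (s i)\<^sup>2) = 0" using norm_svd_part[OF Z, of "{..<k + q}"] by simp
  then have "s 0 = 0" using k by (subst (asm) sum_nonneg_eq_0_iff) auto
  then have "s i = 0" for i using s0[of i] dec[of 0 i] by simp
  then have "Z = 0" using Z by (simp add: svd_def)
  then show False using Z0 by simp
qed

section \<open>Restricted isometry in the Euclidean norm\<close>

text \<open>Polarisation after normalising \<open>X\<close> and \<open>Y\<close>: the sum and the
  difference have squared norm 2, so four times the inner product of the images is at most
  \<open>2 * (1 + \<alpha>) - 2 * (1 - \<alpha>)\<close>.\<close>

lemma rip_inner_le:
  fixes A :: "'a::real_inner \<Rightarrow> 'b::real_inner"
  assumes A: "linear A" and XY: "X \<bullet> Y = 0"
    and rip: "\<And>a b. (1 - \<alpha>) * (norm (a *\<^sub>R X + b *\<^sub>R Y))\<^sup>2 \<le> (norm (A (a *\<^sub>R X + b *\<^sub>R Y)))\<^sup>2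
      \<and> (norm (A (a *\<^sub>R X + b *\<^sub>R Y)))\<^sup>2 \<le> (1 + \<alpha>) * (norm (a *\<^sub>R X + b *\<^sub>R Y))\<^sup>2"
  shows "A X \<bullet> A Y \<le> \<alpha> * norm X * norm Y"
proof (cases "X = 0 \<or> Y = 0")
  case True
  then show ?thesis using linear_0[OF A] by auto
next
  case False
  then have nz: "0 < norm X" "0 < norm Y" by auto
  let ?a = "1 / norm X" and ?b = "1 / norm Y"
  have unit: "(norm (?a *\<^sub>R X + e *\<^sub>R Y))\<^sup>2 = 2" if "e = ?b \<or> e = - ?b" for e
  proof -
    have "(norm (?a *\<^sub>R X + e *\<^sub>R Y))\<^sup>2 = ?a\<^sup>2 * (X \<bullet> X) + e\<^sup>2 * (Y \<bullet> Y)"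
      using XY unfolding power2_norm_eq_inner
      by (simp add: inner_add_left inner_add_right inner_commute[of Y X] power2_eq_square)
    also have "\<dots> = (?a * norm X)\<^sup>2 + (e * norm Y)\<^sup>2"
      by (simp only: power_mult_distrib power2_norm_eq_inner)
    finally show ?thesis using that nz by auto
  qed
  have im: "(norm (A (?a *\<^sub>R X + e *\<^sub>R Y)))\<^sup>2
      = ?a\<^sup>2 * (A X \<bullet> A X) + 2 * ?a * e * (A X \<bullet> A Y) + e\<^sup>2 * (A Y \<bullet> A Y)" for e
    unfolding power2_norm_eq_inner linear_add[OF A] linear_cmul[OF A]
    by (simp add: inner_add_left inner_add_right inner_commute[of "A Y" "A X"] power2_eq_square algebra_simps)
  have "(norm (A (?a *\<^sub>R X + ?b *\<^sub>R Y)))\<^sup>2 \<le> (1 + \<alpha>) * 2"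
    using conjunct2[OF rip[of ?a ?b]] unit[of ?b] by simp
  moreover have "(1 - \<alpha>) * 2 \<le> (norm (A (?a *\<^sub>R X + (- ?b) *\<^sub>R Y)))\<^sup>2"
    using conjunct1[OF rip[of ?a "- ?b"]] unit[of "- ?b"] by simp
  ultimately have "4 * (?a * ?b * (A X \<bullet> A Y)) \<le> 4 * \<alpha>"
    unfolding im by simp
  then have "?a * ?b * (A X \<bullet> A Y) \<le> \<alpha>" by simp
  then show ?thesis using nz by (simp add: field_simps)
qed

section \<open>The scalar inequality behind the constant 1.0873\<close>

text \<open>Bounding the power factor by 1 and the product by the squared mean leaves
  \<open>(1 + \<alpha>)\<^sup>2 / 4 < 1 - \<alpha>\<close>, true below
  \<open>2 * sqrt 3 - 3\<close>, about 0.464; hence the threshold \<open>46 / 100\<close>.\<close>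

lemma rip_bound_large_gap:
  fixes x \<alpha> p :: real
  assumes x: "0 \<le> x" "x \<le> 1" and p: "0 < p" "p < 1" and \<alpha>: "0 < \<alpha>" "\<alpha> \<le> 46 / 100"
  shows "x powr (2 - 2 * p) * ((1 - x powr p) * (x powr p + \<alpha>)) < 1 - \<alpha>"
proof -
  let ?w = "x powr p"
  have w: "0 \<le> ?w" "?w \<le> 1" using x p by (auto simp: powr_le1)
  have "x powr (2 - 2 * p) \<le> 1" using x p by (simp add: powr_le1)
  then have "x powr (2 - 2 * p) * ((1 - ?w) * (?w + \<alpha>)) \<le> 1 * ((1 - ?w) * (?w + \<alpha>))"
    using w \<alpha> by (intro mult_right_mono) auto
  also have "\<dots> \<le> ((1 + \<alpha>) / 2)\<^sup>2"
    using zero_le_power2[of "?w - (1 - \<alpha>) / 2"] by (simp add: power2_eq_square field_simps)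
  also have "\<dots> \<le> ((1 + 46 / 100) / 2)\<^sup>2" using \<alpha> by (intro power_mono) auto
  also have "\<dots> < 54 / 100" by (simp add: power2_eq_square)
  also have "\<dots> \<le> 1 - \<alpha>" using \<alpha> by simp
  finally show ?thesis .
qed

text \<open>The quadratic Taylor bound at \<open>1 / 2\<close> is 1.625, and its square exceeds
  2.64.\<close>

lemma exp_1_gt: "2.64 < exp (1 :: real)"
proof -
  have "(1 + 1 / 2 + (1 / 2)\<^sup>2 / 2 :: real)\<^sup>2 \<le> (exp (1 / 2))\<^sup>2"
    using exp_lower_Taylor_quadratic[of "1 / 2 :: real"] by (intro power_mono) auto
  also have "(exp (1 / 2 :: real))\<^sup>2 = exp 1" by (simp flip: exp_of_nat_mult)
  finally show ?thesis by (simp add: power2_eq_square)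
qed

text \<open>With \<open>y = x powr (2 * p)\<close> and \<open>r = (1 - p) / p\<close>, the left-hand side is at most
  \<open>(1 - y) * y powr r \<le> (1 - y) * exp (- r * (1 - y)) \<le> 1 / (r * exp 1)\<close>.\<close>

lemma rip_bound_small_gap:
  fixes x \<alpha> p :: real
  assumes x: "0 \<le> x" "x \<le> 1" and p: "0 < p" "p < 1.0873 * (1 - \<alpha>)" and \<alpha>: "46 / 100 < \<alpha>" "\<alpha> < 1"
  shows "x powr (2 - 2 * p) * ((1 - x powr p) * (x powr p + \<alpha>)) < 1 - \<alpha>"
proof (cases "x = 0")
  case True
  then show ?thesis using \<alpha> by simp
next
  case False
  then have x0: "0 < x" using x by simp
  have "1.0873 * (1 - \<alpha>) \<le> 1.0873 * (54 / 100)" using \<alpha> by simp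
  then have p': "p < 0.587142" using p by simp
  define y where "y = x powr (2 * p)"
  define r where "r = (1 - p) / p"
  have r: "0 < r" using p p' by (simp add: r_def)
  have y: "0 < y" "y \<le> 1" using x0 x p by (auto simp: y_def powr_le1)
  have w: "0 \<le> x powr p" "x powr p \<le> 1" using x p by (auto simp: powr_le1)
  have ww: "x powr p * x powr p = y" by (simp add: y_def flip: powr_add)
  have "p * r = 1 - p" using p by (simp add: r_def)
  then have "2 * p * r = 2 - 2 * p" unfolding mult.assoc by simp
  then have yr: "x powr (2 - 2 * p) = y powr r" by (simp add: y_def powr_powr)
  have "y powr r \<le> exp (- (r * (1 - y)))"
  proof -
    have "ln y \<le> y - 1" using y ln_le_minus_one by blast
    then have "r * ln y \<le> r * (y - 1)" using r by (intro mult_left_mono) auto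
    then show ?thesis using y by (simp add: powr_def algebra_simps)
  qed
  moreover have "r * (1 - y) * exp (- (r * (1 - y))) \<le> exp (- 1)"
  proof -
    have "r * (1 - y) \<le> exp (r * (1 - y) - 1)" using exp_ge_add_one_self[of "r * (1 - y) - 1"] by simp
    then have "r * (1 - y) * exp (- (r * (1 - y))) \<le> exp (r * (1 - y) - 1) * exp (- (r * (1 - y)))"
      by (rule mult_right_mono) simp
    then show ?thesis by (simp flip: exp_add)
  qed
  ultimately have "r * (1 - y) * y powr r \<le> exp (- 1)"
    using r y by (smt (verit) mult_left_mono mult_nonneg_nonneg)
  then have main: "(1 - y) * y powr r \<le> exp (- 1) / r" using r by (simp add: field_simps)
  have "x powr (2 - 2 * p) * ((1 - x powr p) * (x powr p + \<alpha>))
      \<le> y powr r * ((1 - x powr p) * (x powr p + 1))"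
    unfolding yr using w \<alpha> by (intro mult_left_mono) auto
  also have "(1 - x powr p) * (x powr p + 1) = 1 - y" using ww by (simp add: algebra_simps)
  also have "y powr r * (1 - y) \<le> exp (- 1) / r" using main by (simp add: mult.commute)
  also have "\<dots> = p / ((1 - p) * exp 1)" by (simp add: r_def exp_minus field_simps)
  also have "\<dots> \<le> p / 1.0873"
  proof (rule divide_left_mono)
    \<comment> \<open>Here \<open>0.412858 = 1 - 0.587142\<close> is a lower bound for
      \<open>1 - p\<close>; the product is about 1.0899.\<close>
    have "1.0873 \<le> 0.412858 * (2.64 :: real)" by simp
    also have "\<dots> \<le> (1 - p) * exp 1" using p' exp_1_gt by (intro mult_mono) auto
    finally show "1.0873 \<le> (1 - p) * exp 1" .
    then show "0 < (1 - p) * exp 1 * 1.0873" by simp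
  qed (use p in simp)
  also have "\<dots> < 1 - \<alpha>" using p by simp
  finally show ?thesis .
qed

lemma rip_scalar_bound:
  fixes x \<alpha> p :: real
  assumes "0 \<le> x" "x \<le> 1" "0 < p" "p < 1" "p < 1.0873 * (1 - \<alpha>)" "0 < \<alpha>" "\<alpha> < 1"
  shows "x powr (2 - 2 * p) * ((1 - x powr p) * (x powr p + \<alpha>)) < 1 - \<alpha>"
  using rip_bound_large_gap[of x p \<alpha>] rip_bound_small_gap[of x p \<alpha>] assms by fastforce

text \<open>The head has \<open>2 * k\<close> singular values, the blocks \<open>h j\<close> have
  \<open>k\<close> each. Near-orthogonality of the images bounds the squared norm of
  \<open>A ?H\<close> by the sum of the squared block norms plus \<open>\<alpha>\<close> times the
  square of their sum. If the claim fails, this is below \<open>(1 - \<alpha>)\<close> times the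
  squared norm of the head.\<close>

lemma rip_imp_null_space_property:
  fixes A :: "real ^ 'n ^ 'm \<Rightarrow> real ^ 'l"
  assumes A: "linear A" and p: "0 < p" "p < 1" "p < 1.0873 * (1 - \<alpha>)" and \<alpha>: "0 < \<alpha>" "\<alpha> < 1"
    and k: "1 \<le> k"
    and rip: "\<And>X. rank X \<le> 2 * k \<Longrightarrow> (1 - \<alpha>) * (norm X)\<^sup>2 \<le> (norm (A X))\<^sup>2
      \<and> (norm (A X))\<^sup>2 \<le> (1 + \<alpha>) * (norm X)\<^sup>2"
    and AZ: "A Z = 0" and Z0: "Z \<noteq> 0" and Z: "svd Z u v s"
  shows "(\<Sum>i<k. s i powr p) < (\<Sum>i\<in>{k..<CARD('m)}. s i powr p)"
proof (rule ccontr)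
  let ?m = "CARD('m)"
  define S where "S = (\<Sum>i<k. s i powr p)"
  assume "\<not> ?thesis"
  then have tail: "(\<Sum>i\<in>{k..<?m}. s i powr p) \<le> S" by (simp add: S_def)
  note s0 = svd_nonneg[OF Z] and dec = svd_decreasing[OF Z]
  \<comment> \<open>The \<open>p\<close>-mean of the first \<open>k\<close> singular values. Below,
    \<open>t\<close> is the largest value outside the head and \<open>M\<close> the power sum
    outside the head.\<close>
  define g where "g = (S / real k) powr (1 / p)"
  define t where "t = s (2 * k)"
  define M where "M = (\<Sum>j<?m. \<Sum>i\<in>block (2 * k) k j. s i powr p)"
  define h where "h = (\<lambda>j. svd_part u v s (block (2 * k) k j))"
  let ?H = "svd_part u v s {..<2 * k}"
  have "0 < s 0"
  proof (rule ccontr)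
    assume "\<not> 0 < s 0"
    then have "s i = 0" for i using s0[of 0] s0[of i] dec[of 0 i] by simp
    then show False using Z Z0 by (simp add: svd_def)
  qed
  then have "0 < s 0 powr p" by simp
  also have "\<dots> \<le> S" unfolding S_def using k by (intro member_le_sum) auto
  finally have S: "0 < S" .
  then have g: "0 < g" using k by (simp add: g_def)
  have gp: "real k * g powr p = S" using S k p by (simp add: g_def powr_powr)
  have t0: "0 \<le> t" by (simp add: t_def s0)
  have kk: "2 * k = k + k" by simp
  have tails: "(\<Sum>j<?m. \<Sum>i\<in>block k k j. s i powr p) \<le> S"
    using sum_singular_values_tail[OF Z k, of "\<lambda>t. t powr p" k] tail by simp
  have heads: "real k * s (2 * k + j * k) powr p \<le> (\<Sum>i\<in>block k k j. s i powr p)" for j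
    unfolding kk using block_head_le_previous[of s p k k j] s0 dec p by blast
  have M0: "0 \<le> M" unfolding M_def by (intro sum_nonneg) simp
  \<comment> \<open>The tail from \<open>k\<close> on consists of the block from \<open>k\<close> to
    \<open>2 * k - 1\<close>, whose \<open>k\<close> entries are at least \<open>t\<close>, and of
    the part counted by \<open>M\<close>.\<close>
  have MS: "M + real k * t powr p \<le> S"
  proof -
    have "M + (\<Sum>i\<in>block k k 0. s i powr p) = (\<Sum>j<Suc ?m. \<Sum>i\<in>block k k j. s i powr p)"
      unfolding M_def by (subst sum.lessThan_Suc_shift) (simp add: block_Suc kk)
    also have "\<dots> = (\<Sum>i\<in>{k..<k + Suc ?m * k}. s i powr p)" by (rule sum_blocks)
    also have "\<dots> = (\<Sum>i\<in>{k..<k + ?m * k}. s i powr p)"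
    proof (rule sum.mono_neutral_right)
      have "?m \<le> k + ?m * k" using mult_le_mono2[OF k, of ?m] by linarith
      then show "\<forall>i\<in>{k..<k + Suc ?m * k} - {k..<k + ?m * k}. s i powr p = 0"
        using Z by (auto simp: svd_def)
    qed auto
    also have "\<dots> \<le> S" using tails by (simp add: sum_blocks)
    finally show ?thesis using heads[of 0] by (simp add: t_def)
  qed
  then have Mg: "M \<le> real k * (g powr p - t powr p)" using gp by (simp add: algebra_simps)
  have "0 \<le> real k * (g powr p - t powr p)" using M0 Mg by linarith
  then have "t powr p \<le> g powr p" using k by (simp add: zero_le_mult_iff)
  then have tg: "t \<le> g" using g t0 p by (metis not_le powr_less_mono2 order_less_imp_le)
  have hj: "norm (h j) \<le> t powr (1 - p) * (sqrt (s (2 * k + j * k) powr p) * sqrt (\<Sum>i\<in>block (2 * k) k j. s i powr p))"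
    and hj2: "(norm (h j))\<^sup>2 \<le> t powr (2 - p) * (\<Sum>i\<in>block (2 * k) k j. s i powr p)" for j
  proof -
    let ?t = "s (2 * k + j * k)" and ?M = "\<Sum>i\<in>block (2 * k) k j. s i powr p"
    have M: "0 \<le> ?M" by (intro sum_nonneg) simp
    have tt: "?t \<le> t" unfolding t_def by (rule dec) simp
    have sq: "x\<^sup>2 = x powr (2 - p) * x powr p" if "0 \<le> x" for x :: real
      using that by (simp flip: powr_add powr_numeral)
    have "(norm (h j))\<^sup>2 \<le> (\<Sum>i\<in>block (2 * k) k j. ?t powr (2 - p) * s i powr p)"
      unfolding h_def norm_svd_part[OF Z finite_block] sq[OF s0]
      using s0 dec p by (intro sum_mono mult_right_mono powr_mono2) (auto simp: block_def)
    then have hM: "(norm (h j))\<^sup>2 \<le> ?t powr (2 - p) * ?M" by (simp add: sum_distrib_left)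
    also have "\<dots> \<le> t powr (2 - p) * ?M"
      using tt s0 p M by (intro mult_right_mono powr_mono2) auto
    finally show "(norm (h j))\<^sup>2 \<le> t powr (2 - p) * ?M" .
    \<comment> \<open>Only the factor with exponent \<open>2 - 2 * p\<close> is replaced by
      \<open>t\<close>; the factor \<open>?t powr p\<close> is kept for the Cauchy-Schwarz
      inequality over the blocks.\<close>
    have "?t powr (2 - p) = (?t powr (1 - p))\<^sup>2 * ?t powr p"
      by (simp add: power2_eq_square flip: powr_add)
    also have "\<dots> \<le> (t powr (1 - p))\<^sup>2 * ?t powr p"
      using tt s0 p by (intro mult_right_mono power_mono powr_mono2) auto
    finally have "(norm (h j))\<^sup>2 \<le> (t powr (1 - p))\<^sup>2 * ?t powr p * ?M"
      using hM M by (meson mult_right_mono order_trans)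
    also have "\<dots> = (t powr (1 - p) * (sqrt (?t powr p) * sqrt ?M))\<^sup>2"
      using M by (simp add: power_mult_distrib)
    finally show "norm (h j) \<le> t powr (1 - p) * (sqrt (?t powr p) * sqrt ?M)"
      by (rule power2_le_imp_le) (use M in simp)
  qed
  have sum2: "(\<Sum>j<?m. (norm (h j))\<^sup>2) \<le> t powr (2 - p) * M"
    unfolding M_def by (subst sum_distrib_left) (intro sum_mono hj2)
  have sum1: "(\<Sum>j<?m. norm (h j))\<^sup>2 \<le> t powr (2 - 2 * p) * (g powr p * M)"
  proof -
    let ?a = "\<lambda>j. sqrt (s (2 * k + j * k) powr p)"
      and ?b = "\<lambda>j. sqrt (\<Sum>i\<in>block (2 * k) k j. s i powr p)"
    have "(\<Sum>j<?m. norm (h j)) \<le> t powr (1 - p) * (\<Sum>j<?m. ?a j * ?b j)"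
      unfolding sum_distrib_left by (intro sum_mono hj)
    then have "(\<Sum>j<?m. norm (h j))\<^sup>2 \<le> (t powr (1 - p) * (\<Sum>j<?m. ?a j * ?b j))\<^sup>2"
      by (intro power_mono sum_nonneg) auto
    also have "\<dots> = t powr (2 - 2 * p) * (\<Sum>j<?m. ?a j * ?b j)\<^sup>2"
      by (simp add: power_mult_distrib) (simp add: power2_eq_square flip: powr_add)
    also have "(\<Sum>j<?m. ?a j * ?b j)\<^sup>2 \<le> (\<Sum>j<?m. (?a j)\<^sup>2) * (\<Sum>j<?m. (?b j)\<^sup>2)"
      by (rule Cauchy_Schwarz_ineq_sum)
    also have "(\<Sum>j<?m. (?b j)\<^sup>2) = M" unfolding M_def by (simp add: sum_nonneg)
    also have "(\<Sum>j<?m. (?a j)\<^sup>2) \<le> g powr p"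
    proof -
      have "real k * (\<Sum>j<?m. (?a j)\<^sup>2) = (\<Sum>j<?m. real k * s (2 * k + j * k) powr p)"
        by (simp add: sum_distrib_left)
      also have "\<dots> \<le> (\<Sum>j<?m. \<Sum>i\<in>block k k j. s i powr p)" by (intro sum_mono heads)
      also have "\<dots> \<le> real k * g powr p" using tails gp by simp
      finally show ?thesis using k by simp
    qed
    finally show ?thesis using M0 by (simp add: mult_left_mono mult_right_mono)
  qed
  \<comment> \<open>The diagonal terms use the upper isometry bound; off the diagonal, distinct
    blocks are orthogonal and their combinations have rank at most \<open>2 * k\<close>.\<close>
  have cross: "A (h i) \<bullet> A (h j) \<le> (if i = j then (norm (h i))\<^sup>2 else 0) + \<alpha> * (norm (h i) * norm (h j))" for i j
  proof (cases "i = j")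
    case True
    have "rank (h i) \<le> 2 * k"
      using rank_svd_part[of "block (2 * k) k i" u v s] by (simp add: h_def)
    then show ?thesis using rip[of "h i"] True by (simp add: power2_norm_eq_inner[symmetric] power2_eq_square algebra_simps)
  next
    case False
    have "A (h i) \<bullet> A (h j) \<le> \<alpha> * norm (h i) * norm (h j)"
    proof (rule rip_inner_le[OF A])
      show "h i \<bullet> h j = 0"
        unfolding h_def using inner_svd_part[OF Z, of "block (2 * k) k i" "block (2 * k) k j"]
          block_disjoint[OF False] by simp
      fix a b
      have "rank (a *\<^sub>R h i + b *\<^sub>R h j) \<le> card (block (2 * k) k i \<union> block (2 * k) k j)"
        unfolding h_def by (rule rank_svd_part_combination) simp_all
      also have "\<dots> \<le> 2 * k"
        using card_Un_le[of "block (2 * k) k i" "block (2 * k) k j"] by simp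
      finally show "(1 - \<alpha>) * (norm (a *\<^sub>R h i + b *\<^sub>R h j))\<^sup>2 \<le> (norm (A (a *\<^sub>R h i + b *\<^sub>R h j)))\<^sup>2
        \<and> (norm (A (a *\<^sub>R h i + b *\<^sub>R h j)))\<^sup>2 \<le> (1 + \<alpha>) * (norm (a *\<^sub>R h i + b *\<^sub>R h j))\<^sup>2"
        by (rule rip)
    qed
    then show ?thesis using False by simp
  qed
  have "0 = A (?H + (\<Sum>j<?m. h j))"
    unfolding h_def using AZ svd_block_decomposition[OF Z k, of "2 * k"] by simp
  then have AH: "A ?H = - (\<Sum>j<?m. A (h j))"
    by (simp add: linear_add[OF A] linear_sum[OF A] eq_neg_iff_add_eq_0)
  have "(1 - \<alpha>) * (norm ?H)\<^sup>2 \<le> (norm (A ?H))\<^sup>2"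
    using rip[of ?H] rank_svd_part[of "{..<2 * k}" u v s] by simp
  also have "\<dots> = (\<Sum>i<?m. \<Sum>j<?m. A (h i) \<bullet> A (h j))"
    unfolding AH power2_norm_eq_inner inner_minus_left inner_minus_right minus_minus inner_sum_left
    by (simp add: inner_sum_right)
  also have "\<dots> \<le> (\<Sum>i<?m. \<Sum>j<?m. (if i = j then (norm (h i))\<^sup>2 else 0) + \<alpha> * (norm (h i) * norm (h j)))"
    by (intro sum_mono cross)
  also have "\<dots> = (\<Sum>i<?m. (norm (h i))\<^sup>2) + \<alpha> * (\<Sum>i<?m. norm (h i))\<^sup>2"
    unfolding power2_eq_square[of "\<Sum>i<?m. norm (h i)"] sum_product
    by (simp add: sum.distrib sum_distrib_left)
  also have "\<dots> \<le> t powr (2 - p) * M + \<alpha> * (t powr (2 - 2 * p) * (g powr p * M))"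
    using sum1 sum2 \<alpha> by (intro add_mono mult_left_mono) auto
  also have "t powr (2 - p) = t powr (2 - 2 * p) * t powr p" by (simp flip: powr_add)
  also have "t powr (2 - 2 * p) * t powr p * M + \<alpha> * (t powr (2 - 2 * p) * (g powr p * M))
      = t powr (2 - 2 * p) * (t powr p + \<alpha> * g powr p) * M" by (simp add: algebra_simps)
  also have "\<dots> \<le> t powr (2 - 2 * p) * (t powr p + \<alpha> * g powr p) * (real k * (g powr p - t powr p))"
    using Mg \<alpha> by (intro mult_left_mono) auto
  also have "\<dots> < (1 - \<alpha>) * (real k * g\<^sup>2)"
  proof -
    \<comment> \<open>By homogeneity only the ratio of \<open>t\<close> to \<open>g\<close> matters
      once the factor \<open>g\<^sup>2\<close> is split off.\<close>
    define x where "x = t / g"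
    have x: "0 \<le> x" "x \<le> 1" and tx: "t = g * x" using t0 tg g by (auto simp: x_def)
    have "g powr (2 - 2 * p) * (g powr p * g powr p) = g powr 2" by (simp flip: powr_add)
    then have gg: "g powr (2 - 2 * p) * (g powr p * g powr p) = g\<^sup>2" using g by simp
    have "t powr (2 - 2 * p) * (t powr p + \<alpha> * g powr p) * (real k * (g powr p - t powr p))
        = g powr (2 - 2 * p) * (g powr p * g powr p) * real k
          * (x powr (2 - 2 * p) * ((1 - x powr p) * (x powr p + \<alpha>)))"
      unfolding tx using g x by (simp add: powr_mult algebra_simps)
    also have "\<dots> = g\<^sup>2 * real k * (x powr (2 - 2 * p) * ((1 - x powr p) * (x powr p + \<alpha>)))"
      by (simp only: gg)
    also have "\<dots> < g\<^sup>2 * real k * (1 - \<alpha>)"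
      using rip_scalar_bound[OF x p(1,2,3) \<alpha>] g k by (intro mult_strict_left_mono) auto
    finally show ?thesis by (simp add: mult_ac)
  qed
  finally have "(norm ?H)\<^sup>2 < real k * g\<^sup>2" using \<alpha> by simp
  \<comment> \<open>The \<open>p\<close>-mean of the first \<open>k\<close> singular values is at
    most their quadratic mean, and the head contains them.\<close>
  moreover have "real k * g\<^sup>2 \<le> (norm ?H)\<^sup>2"
  proof -
    have "real k * g powr p \<le> real k powr (1 - p / 2) * (\<Sum>i<k. (s i)\<^sup>2) powr (p / 2)"
      using sum_powr_le_power_mean[of p "{..<k}" s] p s0 gp by (simp add: S_def)
    moreover have "real k * g powr p = real k powr (1 - p / 2) * (real k * g\<^sup>2) powr (p / 2)"
    proof -
      have "real k = real k powr (1 - p / 2) * real k powr (p / 2)" using k by (simp flip: powr_add)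
      then show ?thesis using g by (simp add: powr_mult power2_powr_half)
    qed
    ultimately have "(real k * g\<^sup>2) powr (p / 2) \<le> (\<Sum>i<k. (s i)\<^sup>2) powr (p / 2)"
      using k by simp
    then have "real k * g\<^sup>2 \<le> (\<Sum>i<k. (s i)\<^sup>2)"
      using p by (metis not_le powr_less_mono2 half_gt_zero sum_nonneg zero_le_power2)
    also have "\<dots> \<le> (norm ?H)\<^sup>2"
      unfolding norm_svd_part[OF Z finite_lessThan] by (rule sum_mono2) auto
    finally show ?thesis .
  qed
  ultimately show False by simp
qed

section \<open>Recovery under the two isometry conditions\<close>

theorem theorem5:
  fixes A :: "real ^ 'n ^ 'm \<Rightarrow> real ^ 'l" and p :: real
  assumes "linear A" and "CARD('m) \<le> CARD('n)" and "0 < p" and "p < 1"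
  shows
    "(\<forall>(k :: nat) (\<alpha> :: real).
        1 \<le> k \<and> 2 * k \<le> CARD('m) \<and> 0 < \<alpha> \<and> \<alpha> < 1 \<and>
        (\<forall>X. rank X \<le> 2 * k \<longrightarrow>
           (1 - \<alpha>) * (norm X)\<^sup>2 \<le> (norm (A X))\<^sup>2 \<and>
           (norm (A X))\<^sup>2 \<le> (1 + \<alpha>) * (norm X)\<^sup>2) \<and>
        p < min 1 (1.0873 * (1 - \<alpha>))
        \<longrightarrow> (\<forall>Xbar y. rank Xbar \<le> k \<and> y = A Xbar \<longrightarrow> exactly_recovered A p y Xbar))
     \<and>
     (\<forall>(k :: nat) (b :: real) (a :: real) (\<beta>1 :: real) (\<beta>2 :: real).
        1 \<le> k \<and> 1 < b \<and>
        a = of_int \<lceil>b powr (2 / (2 - p)) * real k\<rceil> / real k \<and>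
        (a + 1) * real k \<le> real CARD('m) \<and>
        0 < \<beta>1 \<and> \<beta>1 < 1 \<and> 0 < \<beta>2 \<and> \<beta>2 < 1 \<and>
        (\<forall>X. real (rank X) \<le> a * real k \<longrightarrow>
           (1 - \<beta>1) * norm X powr p \<le> lp_pow p (A X) \<and>
           lp_pow p (A X) \<le> (1 + \<beta>1) * norm X powr p) \<and>
        (\<forall>X. real (rank X) \<le> (a + 1) * real k \<longrightarrow>
           (1 - \<beta>2) * norm X powr p \<le> lp_pow p (A X) \<and>
           lp_pow p (A X) \<le> (1 + \<beta>2) * norm X powr p) \<and>
        \<beta>1 + b * \<beta>2 < b - 1
        \<longrightarrow> (\<forall>Xbar y. rank Xbar \<le> k \<and> y = A Xbar \<longrightarrow> exactly_recovered A p y Xbar))"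
proof (rule conjI; intro allI impI; elim conjE; hypsubst?)
  fix k :: nat and \<alpha> :: real and Xbar :: "real ^ 'n ^ 'm" and y
  assume k: "1 \<le> k" "2 * k \<le> CARD('m)" and \<alpha>: "0 < \<alpha>" "\<alpha> < 1"
    and rip: "\<forall>X. rank X \<le> 2 * k \<longrightarrow>
           (1 - \<alpha>) * (norm X)\<^sup>2 \<le> (norm (A X))\<^sup>2 \<and> (norm (A X))\<^sup>2 \<le> (1 + \<alpha>) * (norm X)\<^sup>2"
    and p\<alpha>: "p < min 1 (1.0873 * (1 - \<alpha>))" and X: "rank Xbar \<le> k"
  show "exactly_recovered A p (A Xbar) Xbar"
  proof (rule null_space_property_imp_recovery[OF assms(1,2)])
    show "(\<Sum>i<k. s i powr p) < (\<Sum>i\<in>{k..<CARD('m)}. s i powr p)"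
      if "A Z = 0" "Z \<noteq> 0" "svd Z u v s" for Z u v s
    proof (rule rip_imp_null_space_property[OF assms(1,3,4) _ \<alpha> k(1) _ that])
      show "p < 1.0873 * (1 - \<alpha>)" using p\<alpha> by simp
    qed (use rip in blast)
  qed (use assms k X in auto)
next
  fix k :: nat and b a \<beta>1 \<beta>2 :: real and Xbar :: "real ^ 'n ^ 'm" and y
  assume k: "1 \<le> k" and b: "1 < b"
    and dim: "(of_int \<lceil>b powr (2 / (2 - p)) * real k\<rceil> / real k + 1) * real k \<le> real CARD('m)"
    and \<beta>: "0 < \<beta>1" "\<beta>1 + b * \<beta>2 < b - 1"
    and rip1: "\<forall>X. real (rank X) \<le> of_int \<lceil>b powr (2 / (2 - p)) * real k\<rceil> / real k * real k \<longrightarrow>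
           (1 - \<beta>1) * norm X powr p \<le> lp_pow p (A X) \<and>
           lp_pow p (A X) \<le> (1 + \<beta>1) * norm X powr p"
    and rip2: "\<forall>X. real (rank X) \<le> (of_int \<lceil>b powr (2 / (2 - p)) * real k\<rceil> / real k + 1) * real k \<longrightarrow>
           (1 - \<beta>2) * norm X powr p \<le> lp_pow p (A X) \<and>
           lp_pow p (A X) \<le> (1 + \<beta>2) * norm X powr p"
    and X: "rank Xbar \<le> k"
  \<comment> \<open>The natural number \<open>a * k\<close>, taken as the block size; the head then
    has \<open>k + q = (a + 1) * k\<close> singular values.\<close>
  define q where "q = nat \<lceil>b powr (2 / (2 - p)) * real k\<rceil>"
  have pos: "0 < b powr (2 / (2 - p)) * real k" using b k by simp
  then have q: "real_of_int \<lceil>b powr (2 / (2 - p)) * real k\<rceil> = real q" and q1: "1 \<le> q"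
    by (simp_all add: q_def Suc_le_eq)
  have qk: "real q / real k * real k = real q" "(real q / real k + 1) * real k = real (k + q)"
    using k by (simp_all add: field_simps)
  have bq: "b powr (2 / (2 - p)) * real k \<le> real q" unfolding q[symmetric] by (rule le_of_int_ceiling)
  have "real k / real q \<le> inverse (b powr (2 / (2 - p)))"
    using bq b q1 by (simp add: field_simps)
  then have "(real k / real q) powr (1 - p / 2) \<le> inverse (b powr (2 / (2 - p))) powr (1 - p / 2)"
    using assms by (intro powr_mono2) auto
  also have "\<dots> = inverse (b powr (2 / (2 - p) * (1 - p / 2)))"
    by (simp add: powr_powr flip: powr_minus)
  \<comment> \<open>The exponent in the definition of \<open>a\<close> is chosen so that the ratio
    \<open>(k / q) powr (1 - p / 2)\<close> is at most \<open>1 / b\<close>.\<close>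
  also have "2 / (2 - p) * (1 - p / 2) = 1" using assms by (simp add: field_simps)
  finally have "(real k / real q) powr (1 - p / 2) \<le> 1 / b" using b by (simp add: inverse_eq_divide)
  then have "(1 + \<beta>1) * (real k / real q) powr (1 - p / 2) \<le> (1 + \<beta>1) * (1 / b)"
    using \<beta> by (intro mult_left_mono) auto
  \<comment> \<open>Multiplied by \<open>b\<close>, this is the assumption
    \<open>\<beta>1 + b * \<beta>2 < b - 1\<close>.\<close>
  also have "\<dots> < 1 - \<beta>2" using \<beta>(2) b by (simp add: field_simps)
  finally have ratio: "(1 + \<beta>1) * (real k / real q) powr (1 - p / 2) < 1 - \<beta>2" .
  show "exactly_recovered A p (A Xbar) Xbar"
  proof (rule null_space_property_imp_recovery[OF assms(1,2)])
    have "real (k + q) \<le> real CARD('m)" using dim unfolding q qk .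
    then show "k \<le> CARD('m)" by simp
    show "(\<Sum>i<k. s i powr p) < (\<Sum>i\<in>{k..<CARD('m)}. s i powr p)"
      if "A Z = 0" "Z \<noteq> 0" "svd Z u v s" for Z u v s
    proof (rule lp_rip_imp_null_space_property[OF assms(1,3,4) k q1 _ _ _ ratio that])
      fix X :: "real ^ 'n ^ 'm"
      show "lp_pow p (A X) \<le> (1 + \<beta>1) * norm X powr p" if "rank X \<le> q"
        using rip1[unfolded q qk] that by simp
      show "(1 - \<beta>2) * norm X powr p \<le> lp_pow p (A X)" if "rank X \<le> k + q"
        using rip2[unfolded q qk of_nat_le_iff] that by blast
    qed (use \<beta> in simp)
  qed (use assms X in auto)
qed

end
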